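(* Let $K\subset\mathbb{R}^2$ be a (non-degenerate) triangle and let $\mathbb{X}_\triangle(K)=\operatorname{sym}(\boldsymbol{RT}^0(K)\otimes\boldsymbol{RT}^1(K))$. Then: (a) $\widehat{\boldsymbol M}\in\mathbb{X}_\triangle(\widehat K)$ if and only if $\mathcal{H}_K(\widehat{\boldsymbol M})\in\mathbb{X}_\triangle(K)$; (b) $\mathbb{X}_\triangle(K)=\mathbb{P}^1_{\mathrm{sym}}(K)\oplus\widetilde{\mathbb{P}}^2(K)\oplus\boldsymbol{x}\boldsymbol{x}^\top P^1(K)$; (c) $\dim(\mathbb{X}_\triangle(K))=15$; (d) $\mathbb{P}^1_{\mathrm{sym}}(K)\subseteq\mathbb{X}_\triangle(K)\subseteq\mathbb{P}^3_{\mathrm{sym}}(K)$; (e) $\operatorname{div}\mathbf{div}(\mathbb{X}_\triangle(K))=P^1(K)$; (f) $\boldsymbol n\cdot\boldsymbol M\boldsymbol n|_E\in P^1(E)$ for all edges $E$ of $K$ and all $\boldsymbol M\in\mathbb{X}_\triangle(K)$; (g) $(\boldsymbol n\cdot\mathbf{div}\boldsymbol M+\partial_{\boldsymbol t}(\boldsymbol t\cdot\boldsymbol M\boldsymbol n))|_E\in P^1(E)$ for all edges $E$ of $K$ and all $\boldsymbol M\in\mathbb{X}_\triangle(K)$.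
   Context: $P^p(K)$, $P^p(E)$: polynomials of degree $\le p$ on $K$, on an edge $E$; $P^p_{\mathrm{hom}}(K)$: homogeneous polynomials of degree $p$; $\boldsymbol P^p(K)=P^p(K)^2$; $\mathbb{P}^p_{\mathrm{sym}}(K)$: symmetric $2\times2$ tensors with entries in $P^p(K)$. $\boldsymbol x$ denotes the function $(x,y)\mapsto(x,y)^\top$. $\boldsymbol{RT}^p(K)=\boldsymbol P^p(K)\oplus\boldsymbol x P^p_{\mathrm{hom}}(K)$. $\operatorname{sym}(\boldsymbol M)=\frac12(\boldsymbol M+\boldsymbol M^\top)$, and $\operatorname{sym}$ of a space is the image under this map. $\boldsymbol X\otimes\boldsymbol Y=\operatorname{span}\{\boldsymbol\phi\boldsymbol\psi^\top:\boldsymbol\phi\in\boldsymbol X,\boldsymbol\psi\in\boldsymbol Y\}$. $\boldsymbol x\boldsymbol x^\top P^1(K)=\{\boldsymbol x\boldsymbol x^\top\eta:\eta\in P^1(K)\}$. $\mathbf{Curl}\,\boldsymbol q$ has rows $\operatorname{curl}q_i=(\partial_yq_i,-\partial_xq_i)$, $\mathbf{sCurl}\,\boldsymbol q=\operatorname{sym}(\mathbf{Curl}\,\boldsymbol q)$, and $\widetilde{\mathbb{P}}^2(K)=\mathbf{sCurl}(P^2_{\mathrm{hom}}(K)\boldsymbol x)$. $\mathbf{div}$ is the row-wise divergence and $\operatorname{div}\mathbf{div}$ the iterated divergence. $\widehat K$ is the reference triangle with vertices $(0,0),(1,0),(0,1)$. For $K$ with vertices $\boldsymbol a_K,\boldsymbol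 b_K,\boldsymbol c_K$ in positive order, $F_K(\widehat{\boldsymbol x})=\boldsymbol B_K\widehat{\boldsymbol x}+\boldsymbol a_K$ with $\boldsymbol B_K=(\boldsymbol b_K-\boldsymbol a_K\;\;\boldsymbol c_K-\boldsymbol a_K)$. The Piola–Kirchhoff transformation $\mathcal{H}_K$ maps a symmetric tensor field $\widehat{\boldsymbol M}$ on $\widehat K$ to the field $\boldsymbol M=\mathcal{H}_K(\widehat{\boldsymbol M})$ on $K$ given by $\det(\boldsymbol B_K)\,\boldsymbol M\circ F_K=\boldsymbol B_K\widehat{\boldsymbol M}\boldsymbol B_K^\top$. $\boldsymbol n$ and $\boldsymbol t$ are the unit exterior normal and the unit tangent (positive orientation) along $\partial K$; $\partial_{\boldsymbol t}$ is the tangential derivative along an edge. *)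

theory Defs
  imports "HOL-Analysis.Analysis" "HOL-Library.Function_Algebras"
begin

text \<open>Pointwise real vector space structure on functions; it supplies \<^const>\<open>span\<close>,
  \<^const>\<open>subspace\<close> and \<^const>\<open>dim\<close> for spaces of fields.\<close>

instantiation "fun" :: (type, real_vector) real_vector
begin

definition scaleR_fun :: "real \<Rightarrow> ('a \<Rightarrow> 'b) \<Rightarrow> 'a \<Rightarrow> 'b" where
  "scaleR_fun c f = (\<lambda>x. c *\<^sub>R f x)"

instance
  by standard (auto simp: scaleR_fun_def fun_eq_iff scaleR_add_right scaleR_add_left)

end

text \<open>A function on a set \<open>S\<close> is represented by the total function that agrees with it on \<open>S\<close> and
  vanishes outside \<open>S\<close>.  So functions on \<open>S\<close> form a vector space under the pointwise operations,
  and two functions on \<open>S\<close> are equal iff they agree on \<open>S\<close>.\<close>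

definition on_set :: "'a set \<Rightarrow> ('a \<Rightarrow> 'b::zero) \<Rightarrow> 'a \<Rightarrow> 'b" where
  "on_set S f = (\<lambda>x. if x \<in> S then f x else 0)"

definition polys :: "nat \<Rightarrow> (real^2) set \<Rightarrow> (real^2 \<Rightarrow> real) set" where
  "polys p S = {on_set S (\<lambda>x. \<Sum>(i, j) \<in> {(i, j). i + j \<le> p}. c i j * (x $ 1) ^ i * (x $ 2) ^ j) |
                  c :: nat \<Rightarrow> nat \<Rightarrow> real. True}"

definition hom_polys :: "nat \<Rightarrow> (real^2) set \<Rightarrow> (real^2 \<Rightarrow> real) set" where
  "hom_polys p S = {on_set S (\<lambda>x. \<Sum>(i, j) \<in> {(i, j). i + j = p}. c i j * (x $ 1) ^ i * (x $ 2) ^ j) |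
                      c :: nat \<Rightarrow> nat \<Rightarrow> real. True}"

definition vec_polys :: "nat \<Rightarrow> (real^2) set \<Rightarrow> (real^2 \<Rightarrow> real^2) set" where
  "vec_polys p S = {u. \<forall>i. (\<lambda>x. u x $ i) \<in> polys p S}"

text \<open>Matrix-valued fields have type \<^typ>\<open>real^2 \<Rightarrow> real^2^2\<close>, where \<open>M x $ i $ j\<close> is the entry
  in row \<open>i\<close> and column \<open>j\<close>.\<close>

definition sym_polys :: "nat \<Rightarrow> (real^2) set \<Rightarrow> (real^2 \<Rightarrow> real^2^2) set" where
  "sym_polys p S = {M. (\<forall>i j. (\<lambda>x. M x $ i $ j) \<in> polys p S) \<and> (\<forall>x. transpose (M x) = M x)}"

text \<open>On a set with nonempty interior this sum is direct, since the second summand is homogeneous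
  of degree \<open>p + 1\<close>.\<close>

definition RT :: "nat \<Rightarrow> (real^2) set \<Rightarrow> (real^2 \<Rightarrow> real^2) set" where
  "RT p S = {u + (\<lambda>x. \<eta> x *\<^sub>R x) | u \<eta>. u \<in> vec_polys p S \<and> \<eta> \<in> hom_polys p S}"

definition outer :: "real^2 \<Rightarrow> real^2 \<Rightarrow> real^2^2" where
  "outer v w = (\<chi> i j. v $ i * w $ j)"

definition tensor_span ::
    "(real^2 \<Rightarrow> real^2) set \<Rightarrow> (real^2 \<Rightarrow> real^2) set \<Rightarrow> (real^2 \<Rightarrow> real^2^2) set" where
  "tensor_span X Y = span {(\<lambda>x. outer (\<phi> x) (\<psi> x)) | \<phi> \<psi>. \<phi> \<in> X \<and> \<psi> \<in> Y}"

definition symm :: "(real^2 \<Rightarrow> real^2^2) \<Rightarrow> real^2 \<Rightarrow> real^2^2" where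
  "symm M = (\<lambda>x. (1/2) *\<^sub>R (M x + transpose (M x)))"

definition X_tri :: "(real^2) set \<Rightarrow> (real^2 \<Rightarrow> real^2^2) set" where
  "X_tri K = symm ` tensor_span (RT 0 K) (RT 1 K)"

text \<open>Partial derivatives of functions on a closed triangle \<open>K\<close> are taken within \<open>K\<close>.  As \<open>K\<close> is
  convex with nonempty interior, the derivative within \<open>K\<close> is unique at every point of \<open>K\<close>; on the
  boundary it is the one-sided derivative, i.e. the continuous extension from the interior when
  the function is smooth up to the boundary.\<close>

definition pd :: "(real^2) set \<Rightarrow> 2 \<Rightarrow> (real^2 \<Rightarrow> real) \<Rightarrow> real^2 \<Rightarrow> real" where
  "pd K i f = on_set K (\<lambda>x. frechet_derivative f (at x within K) (axis i 1))"

definition scalar_curl :: "(real^2) set \<Rightarrow> (real^2 \<Rightarrow> real) \<Rightarrow> real^2 \<Rightarrow> real^2" where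
  "scalar_curl K f = (\<lambda>x. vector [pd K 2 f x, - pd K 1 f x])"

definition Curl :: "(real^2) set \<Rightarrow> (real^2 \<Rightarrow> real^2) \<Rightarrow> real^2 \<Rightarrow> real^2^2" where
  "Curl K q = (\<lambda>x. \<chi> i. scalar_curl K (\<lambda>y. q y $ i) x)"

definition sCurl :: "(real^2) set \<Rightarrow> (real^2 \<Rightarrow> real^2) \<Rightarrow> real^2 \<Rightarrow> real^2^2" where
  "sCurl K q = symm (Curl K q)"

definition div_vec :: "(real^2) set \<Rightarrow> (real^2 \<Rightarrow> real^2) \<Rightarrow> real^2 \<Rightarrow> real" where
  "div_vec K u = (\<lambda>x. \<Sum>j\<in>UNIV. pd K j (\<lambda>y. u y $ j) x)"

definition Div :: "(real^2) set \<Rightarrow> (real^2 \<Rightarrow> real^2^2) \<Rightarrow> real^2 \<Rightarrow> real^2" where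
  "Div K M = (\<lambda>x. \<chi> i. div_vec K (\<lambda>y. M y $ i) x)"

definition div_Div :: "(real^2) set \<Rightarrow> (real^2 \<Rightarrow> real^2^2) \<Rightarrow> real^2 \<Rightarrow> real" where
  "div_Div K M = div_vec K (Div K M)"

definition P2_tilde :: "(real^2) set \<Rightarrow> (real^2 \<Rightarrow> real^2^2) set" where
  "P2_tilde K = sCurl K ` {(\<lambda>x. \<eta> x *\<^sub>R x) | \<eta>. \<eta> \<in> hom_polys 2 K}"

definition xxT_P1 :: "(real^2) set \<Rightarrow> (real^2 \<Rightarrow> real^2^2) set" where
  "xxT_P1 K = {(\<lambda>x. \<eta> x *\<^sub>R outer x x) | \<eta>. \<eta> \<in> polys 1 K}"

definition is_direct_sum3 ::
    "'v::real_vector set \<Rightarrow> 'v set \<Rightarrow> 'v set \<Rightarrow> 'v set \<Rightarrow> bool" where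
  "is_direct_sum3 W U1 U2 U3 \<longleftrightarrow>
     subspace U1 \<and> subspace U2 \<and> subspace U3 \<and>
     bij_betw (\<lambda>(u1, u2, u3). u1 + u2 + u3) (U1 \<times> U2 \<times> U3) W"

definition triangle_of :: "real^2 \<Rightarrow> real^2 \<Rightarrow> real^2 \<Rightarrow> (real^2) set" where
  "triangle_of a b c = convex hull {a, b, c}"

definition ref_triangle :: "(real^2) set" where
  "ref_triangle = triangle_of (vector [0, 0]) (vector [1, 0]) (vector [0, 1])"

definition B_mat :: "real^2 \<Rightarrow> real^2 \<Rightarrow> real^2 \<Rightarrow> real^2^2" where
  "B_mat a b c = transpose (vector [b - a, c - a])"

definition F_map :: "real^2 \<Rightarrow> real^2 \<Rightarrow> real^2 \<Rightarrow> real^2 \<Rightarrow> real^2" where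
  "F_map a b c = (\<lambda>x. B_mat a b c *v x + a)"

text \<open>Nondegenerate, with the vertices listed in positive (counterclockwise) order.\<close>

definition pos_triangle :: "real^2 \<Rightarrow> real^2 \<Rightarrow> real^2 \<Rightarrow> bool" where
  "pos_triangle a b c \<longleftrightarrow> det (B_mat a b c) > 0"

definition sym_field :: "(real^2) set \<Rightarrow> (real^2 \<Rightarrow> real^2^2) \<Rightarrow> bool" where
  "sym_field S M \<longleftrightarrow> on_set S M = M \<and> (\<forall>x. transpose (M x) = M x)"

definition piola ::
    "real^2 \<Rightarrow> real^2 \<Rightarrow> real^2 \<Rightarrow> (real^2 \<Rightarrow> real^2^2) \<Rightarrow> real^2 \<Rightarrow> real^2^2" where
  "piola a b c Mh = on_set (triangle_of a b c)
     (\<lambda>x. (1 / det (B_mat a b c)) *\<^sub>R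
          (B_mat a b c ** Mh (the_inv_into ref_triangle (F_map a b c) x) ** transpose (B_mat a b c)))"

text \<open>The (directed) edge from \<open>u\<close> to \<open>v\<close> of a positively oriented triangle has unit tangent
  \<open>edge_tangent u v\<close>; rotating it clockwise by a right angle gives the exterior unit normal.\<close>

definition edge_tangent :: "real^2 \<Rightarrow> real^2 \<Rightarrow> real^2" where
  "edge_tangent u v = (1 / norm (v - u)) *\<^sub>R (v - u)"

definition edge_normal :: "real^2 \<Rightarrow> real^2 \<Rightarrow> real^2" where
  "edge_normal u v = vector [edge_tangent u v $ 2, - (edge_tangent u v $ 1)]"

definition edges :: "real^2 \<Rightarrow> real^2 \<Rightarrow> real^2 \<Rightarrow> ((real^2) \<times> (real^2)) set" where
  "edges a b c = {(a, b), (b, c), (c, a)}"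

text \<open>Derivative with respect to arc length in direction \<open>t\<close> of a function on the segment \<open>E\<close>.\<close>

definition tangential_deriv ::
    "(real^2) set \<Rightarrow> real^2 \<Rightarrow> (real^2 \<Rightarrow> real) \<Rightarrow> real^2 \<Rightarrow> real" where
  "tangential_deriv E t g x =
     vector_derivative (\<lambda>s. g (x + s *\<^sub>R t)) (at 0 within {s. x + s *\<^sub>R t \<in> E})"

definition nMn :: "real^2 \<Rightarrow> real^2 \<Rightarrow> (real^2 \<Rightarrow> real^2^2) \<Rightarrow> real^2 \<Rightarrow> real" where
  "nMn u v M = on_set (closed_segment u v) (\<lambda>x. edge_normal u v \<bullet> (M x *v edge_normal u v))"

definition eff_shear ::
    "(real^2) set \<Rightarrow> real^2 \<Rightarrow> real^2 \<Rightarrow> (real^2 \<Rightarrow> real^2^2) \<Rightarrow> real^2 \<Rightarrow> real" where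
  "eff_shear K u v M = on_set (closed_segment u v)
     (\<lambda>x. edge_normal u v \<bullet> Div K M x +
          tangential_deriv (closed_segment u v) (edge_tangent u v)
            (\<lambda>y. edge_tangent u v \<bullet> (M y *v edge_normal u v)) x)"

lemma det_B_mat: "det (B_mat a b c) = (b - a) $ 1 * (c - a) $ 2 - (c - a) $ 1 * (b - a) $ 2"
  by (simp add: B_mat_def det_2 transpose_def)

lemma B_mat_mult: "B_mat a b c *v x = (x $ 1) *\<^sub>R (b - a) + (x $ 2) *\<^sub>R (c - a)"
  by (simp add: B_mat_def vec_eq_iff matrix_vector_mult_def transpose_def sum_2 mult.commute)

lemma inj_F_map:
  assumes "pos_triangle a b c"
  shows "inj (F_map a b c)"
proof -
  have "inj ((*v) (B_mat a b c))"
    using assms by (simp add: pos_triangle_def inj_matrix_vector_mult invertible_det_nz)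
  then show ?thesis
    by (simp add: inj_def F_map_def)
qed

lemma F_map_image_ref_triangle: "F_map a b c ` ref_triangle = triangle_of a b c"
proof -
  have "F_map a b c ` ref_triangle =
      (\<lambda>x. a + x) ` ((*v) (B_mat a b c) ` ref_triangle)"
    by (auto simp: F_map_def image_image add.commute)
  also have "(*v) (B_mat a b c) ` ref_triangle = convex hull {0, b - a, c - a}"
    unfolding ref_triangle_def triangle_of_def
    by (subst convex_hull_linear_image) (simp_all add: matrix_vector_mul_linear B_mat_mult)
  also have "(\<lambda>x. a + x) ` (convex hull {0, b - a, c - a}) = triangle_of a b c"
    by (simp add: triangle_of_def flip: convex_hull_translation)
  finally show ?thesis .
qed

text \<open>The defining relation of the Piola--Kirchhoff transformation.\<close>

lemma piola_F_map:
  assumes "pos_triangle a b c" "x \<in> ref_triangle"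
  shows "det (B_mat a b c) *\<^sub>R piola a b c Mh (F_map a b c x) =
         B_mat a b c ** Mh x ** transpose (B_mat a b c)"
proof -
  have "F_map a b c x \<in> triangle_of a b c"
    using F_map_image_ref_triangle assms(2) by blast
  moreover have "the_inv_into ref_triangle (F_map a b c) (F_map a b c x) = x"
    using inj_F_map[OF assms(1)] assms(2)
    by (meson inj_on_subset subset_UNIV the_inv_into_f_f)
  ultimately show ?thesis
    using assms(1) by (simp add: piola_def on_set_def pos_triangle_def)
qed

lemma normal_exterior:
  assumes "pos_triangle a b c" "(u, v) \<in> edges a b c"
  shows "norm (edge_normal u v) = 1" "edge_normal u v \<bullet> edge_tangent u v = 0"
    "x \<in> triangle_of a b c \<Longrightarrow> y \<in> closed_segment u v \<Longrightarrow> edge_normal u v \<bullet> (x - y) \<le> 0"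
proof -
  have D: "(b - a) $ 1 * (c - a) $ 2 - (c - a) $ 1 * (b - a) $ 2 > 0"
    using assms(1) by (simp add: pos_triangle_def det_B_mat)
  have ne: "u \<noteq> v"
    using D assms(2) by (auto simp: edges_def)
  have "norm (edge_normal u v) = norm (edge_tangent u v)"
    by (simp add: edge_normal_def norm_eq_sqrt_inner inner_vec_def sum_2)
  then show "norm (edge_normal u v) = 1"
    using ne by (simp add: edge_tangent_def)
  show "edge_normal u v \<bullet> edge_tangent u v = 0"
    by (simp add: edge_normal_def inner_vec_def sum_2)
  have scale: "norm (v - u) * (edge_normal u v \<bullet> z) = (v - u) $ 2 * z $ 1 - (v - u) $ 1 * z $ 2" for z
  proof -
    define d where "d = v - u"
    have "norm d \<noteq> 0" using ne by (simp add: d_def)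
    then show ?thesis
      unfolding d_def[symmetric] edge_normal_def edge_tangent_def
      by (simp add: inner_vec_def sum_2 field_simps)
  qed
  have nonpos: "edge_normal u v \<bullet> z \<le> 0"
    if "(v - u) $ 2 * z $ 1 - (v - u) $ 1 * z $ 2 \<le> 0" for z
    using that ne unfolding scale[symmetric] by (simp add: mult_le_0_iff)
  have vert: "edge_normal u v \<bullet> (w - u) \<le> 0" if "w \<in> {a, b, c}" for w
    using that assms(2) D
    by (intro nonpos) (auto simp: edges_def algebra_simps)
  have perp: "edge_normal u v \<bullet> (v - u) = 0"
    using ne scale[of "v - u"] by auto
  assume x: "x \<in> triangle_of a b c" and y: "y \<in> closed_segment u v"
  have "triangle_of a b c \<subseteq> {w. edge_normal u v \<bullet> w \<le> edge_normal u v \<bullet> u}"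
    unfolding triangle_of_def
    by (rule hull_minimal) (use vert in \<open>auto simp: inner_diff_right convex_halfspace_le\<close>)
  moreover from y obtain s where "y = u + s *\<^sub>R (v - u)"
    by (auto simp: in_segment algebra_simps)
  then have "edge_normal u v \<bullet> y = edge_normal u v \<bullet> u"
    using perp by (simp add: inner_add_right)
  ultimately show "edge_normal u v \<bullet> (x - y) \<le> 0"
    using x by (auto simp: inner_diff_right)
qed

end

theory Submission
  imports Defs
begin

text \<open>
  Everything follows from a normal form: the fields of \<^const>\<open>X_tri\<close> are exactly
  \<open>M(x) = L(x) + sym(x (C x)\<^sup>T) + (l \<bullet> x) x x\<^sup>T\<close>, where \<open>L\<close> is affine with symmetric values, \<open>C\<close> is a
  \<open>2 \<times> 2\<close> matrix and \<open>l\<close> a vector (\<open>X_tri_eq\<close>).  One inclusion is the expansion of a product of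
  \<open>v + e x\<close> and \<open>w + A x + (l \<bullet> x) x\<close>; for the other, three products suffice.  A polynomial
  that vanishes on a set with interior has zero coefficients, so \<open>(L, C, l)\<close> is determined by the field
  (\<open>inj_X_field\<close>), and the dimension is \<open>9 + 4 + 2\<close>.

  The direct sum is the splitting of \<open>C\<close> into a trace-free part and a multiple of the identity:
  the symmetrized curl of \<open>\<eta> x\<close> with a quadratic form \<open>\<eta>\<close> is \<open>sym(x (C x)\<^sup>T)\<close> with \<open>C x\<close> the
  rotated gradient of \<open>\<eta>\<close>, an arbitrary trace-free \<open>C\<close> (\<open>sCurl_hom_quadratic\<close>), while the identity contributes \<open>x x\<^sup>T\<close>.
  The iterated divergence of \<open>M\<close> is \<open>3 tr C + 12 l \<bullet> x\<close>, an arbitrary polynomial of degree at most one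
  (\<open>div_Div_X_field\<close>).

  On an edge with normal \<open>n\<close> and tangent \<open>t\<close>, \<open>n \<bullet> x\<close> is constant.  The terms of degree two and
  three in \<open>n \<bullet> M n\<close> contain this factor once and twice, so they are affine on the edge.  In
  \<open>t \<bullet> M n\<close> the cubic term contains it once, so the tangential derivative is affine, and
  so is \<open>n \<bullet> div M\<close>, whose only quadratic term is \<open>4 (l \<bullet> x) (n \<bullet> x)\<close>.

  For the Piola--Kirchhoff transformation the definition by products is more convenient than the normal
  form: a congruence acts on each factor of a product, and the Raviart--Thomas spaces are
  invariant because the linear part of an affine map sends the radial field to a radial field up to
  a constant (\<open>RT_0_affine\<close>, \<open>RT_1_affine\<close>, \<open>X_tri_affine\<close>).
\<close>

section \<open>Polynomial spaces through their coefficients\<close>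

lemma on_set_add: "on_set S f + on_set S g = on_set S (\<lambda>x. f x + g x)"
  for f g :: "'a \<Rightarrow> 'b::monoid_add"
  by (auto simp: on_set_def plus_fun_def)

lemma on_set_scaleR: "r *\<^sub>R on_set S f = on_set S (\<lambda>x. r *\<^sub>R f x)"
  for f :: "'a \<Rightarrow> 'b::real_vector"
  by (auto simp: on_set_def scaleR_fun_def)

lemma on_set_cong: "(\<And>x. x \<in> S \<Longrightarrow> f x = g x) \<Longrightarrow> on_set S f = on_set S g"
  by (auto simp: on_set_def)

lemma on_set_nth: "(\<lambda>x. on_set S M x $ i) = on_set S (\<lambda>x. M x $ i)"
  by (auto simp: on_set_def)

lemma on_set_nth_nth: "(\<lambda>x. on_set S M x $ i $ j) = on_set S (\<lambda>x. M x $ i $ j)"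
  by (auto simp: on_set_def)

lemma polys_0: "polys 0 S = {on_set S (\<lambda>x. \<alpha>) | \<alpha>. True}"
proof -
  have I: "{(i, j). i + j = (0::nat)} = {(0, 0)}"
    by auto
  show ?thesis
  proof (intro equalityI subsetI; clarsimp simp: polys_def I)
    fix c :: "nat \<Rightarrow> nat \<Rightarrow> real"
    show "\<exists>\<alpha>. on_set S (\<lambda>x. c 0 0) = on_set S (\<lambda>x. \<alpha>)"
      by (rule exI refl)+
  next
    fix \<alpha> :: real
    show "\<exists>c. on_set S (\<lambda>x. \<alpha>) = on_set S (\<lambda>x. c 0 (0::nat))"
      by (rule exI[of _ "\<lambda>i j. \<alpha>"]) (rule refl)
  qed
qed

lemma polys_1: "polys 1 S = {on_set S (\<lambda>x. \<alpha> + l \<bullet> x) | \<alpha> l. True}"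
proof -
  have I: "{(i, j). i + j \<le> Suc 0} = {(0, 0), (1, 0), (0, 1)}"
    by auto
  show ?thesis
  proof (intro equalityI subsetI; clarsimp simp: polys_def I)
    fix c :: "nat \<Rightarrow> nat \<Rightarrow> real"
    show "\<exists>\<alpha> l. on_set S (\<lambda>x. c 0 0 + (c (Suc 0) 0 * x $ 1 + c 0 (Suc 0) * x $ 2)) = on_set S (\<lambda>x. \<alpha> + l \<bullet> x)"
      by (rule exI[of _ "c 0 0"], rule exI[of _ "vector [c 1 0, c 0 1]"], rule on_set_cong)
        (simp add: inner_vec_def sum_2)
  next
    fix \<alpha> :: real and l :: "real^2"
    show "\<exists>c. on_set S (\<lambda>x. \<alpha> + l \<bullet> x) = on_set S (\<lambda>x. c 0 0 + (c (Suc 0) 0 * x $ 1 + c 0 (Suc 0) * x $ 2))"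
      by (rule exI[of _ "\<lambda>i j. if i = 1 then l $ 1 else if j = 1 then l $ 2 else \<alpha>"], rule on_set_cong)
        (simp add: inner_vec_def sum_2)
  qed
qed

lemma hom_polys_0: "hom_polys 0 S = {on_set S (\<lambda>x. \<alpha>) | \<alpha>. True}"
  using polys_0[of S] by (simp add: polys_def hom_polys_def)

lemma hom_polys_1: "hom_polys 1 S = {on_set S (\<lambda>x. l \<bullet> x) | l. True}"
proof -
  have I: "{(i, j). i + j = Suc 0} = {(1, 0), (0, 1)}"
    by auto
  show ?thesis
  proof (intro equalityI subsetI; clarsimp simp: hom_polys_def I)
    fix c :: "nat \<Rightarrow> nat \<Rightarrow> real"
    show "\<exists>l. on_set S (\<lambda>x. c (Suc 0) 0 * x $ 1 + c 0 (Suc 0) * x $ 2) = on_set S ((\<bullet>) l)"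
      by (rule exI[of _ "vector [c 1 0, c 0 1]"], rule on_set_cong)
        (simp add: inner_vec_def sum_2)
  next
    fix l :: "real^2"
    show "\<exists>c. on_set S ((\<bullet>) l) = on_set S (\<lambda>x. c (Suc 0) 0 * x $ 1 + c 0 (Suc 0) * x $ 2)"
      by (rule exI[of _ "\<lambda>i j. if i = 1 then l $ 1 else l $ 2"], rule on_set_cong)
        (simp add: inner_vec_def sum_2)
  qed
qed

lemma hom_polys_2:
  "hom_polys 2 S = {on_set S (\<lambda>x. \<alpha> * (x $ 1)\<^sup>2 + \<beta> * x $ 1 * x $ 2 + \<gamma> * (x $ 2)\<^sup>2) | \<alpha> \<beta> \<gamma>. True}"
proof -
  have I: "{(i, j). i + j = 2} = {(2, 0), (1, 1), (0, 2::nat)}"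
    by auto
  show ?thesis
  proof (intro equalityI subsetI; clarsimp simp: hom_polys_def I)
    fix c :: "nat \<Rightarrow> nat \<Rightarrow> real"
    show "\<exists>\<alpha> \<beta> \<gamma>. on_set S (\<lambda>x. c 2 0 * (x $ 1)\<^sup>2 + (c (Suc 0) (Suc 0) * x $ 1 * x $ 2 + c 0 2 * (x $ 2)\<^sup>2)) =
       on_set S (\<lambda>x. \<alpha> * (x $ 1)\<^sup>2 + \<beta> * x $ 1 * x $ 2 + \<gamma> * (x $ 2)\<^sup>2)"
      by (intro exI on_set_cong) (rule add.assoc[symmetric])
  next
    fix \<alpha> \<beta> \<gamma> :: real
    show "\<exists>c. on_set S (\<lambda>x. \<alpha> * (x $ 1)\<^sup>2 + \<beta> * x $ 1 * x $ 2 + \<gamma> * (x $ 2)\<^sup>2) =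
       on_set S (\<lambda>x. c 2 0 * (x $ 1)\<^sup>2 + (c (Suc 0) (Suc 0) * x $ 1 * x $ 2 + c 0 2 * (x $ 2)\<^sup>2))"
      by (rule exI[of _ "\<lambda>i j. if i = 2 then \<alpha> else if i = 1 then \<beta> else \<gamma>"], rule on_set_cong) simp
  qed
qed

lemma vec_polys_0: "vec_polys 0 S = {on_set S (\<lambda>x. v) | v. True}"
proof (intro equalityI subsetI)
  fix u assume "u \<in> vec_polys 0 S"
  then obtain \<alpha> where "\<And>i. (\<lambda>x. u x $ i) = on_set S (\<lambda>x. \<alpha> i)"
    unfolding vec_polys_def polys_0 mem_Collect_eq simp_thms by metis
  then have "u = on_set S (\<lambda>x. \<chi> i. \<alpha> i)"
    by (auto simp: fun_eq_iff vec_eq_iff on_set_def)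
  then show "u \<in> {on_set S (\<lambda>x. v) | v. True}"
    by blast
next
  fix u :: "real^2 \<Rightarrow> real^2" assume "u \<in> {on_set S (\<lambda>x. v) | v. True}"
  then show "u \<in> vec_polys 0 S"
    unfolding vec_polys_def polys_0 by (auto simp: on_set_nth)
qed

lemma vec_polys_1: "vec_polys 1 S = {on_set S (\<lambda>x. v + A *v x) | v A. True}"
proof (intro equalityI subsetI)
  fix u assume "u \<in> vec_polys 1 S"
  then obtain \<alpha> l where "\<And>i. (\<lambda>x. u x $ i) = on_set S (\<lambda>x. \<alpha> i + l i \<bullet> x)"
    unfolding vec_polys_def polys_1 mem_Collect_eq simp_thms by metis
  then have "u = on_set S (\<lambda>x. (\<chi> i. \<alpha> i) + (\<chi> i. l i) *v x)"
    by (auto simp: fun_eq_iff vec_eq_iff on_set_def matrix_vector_mul_component)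
  then show "u \<in> {on_set S (\<lambda>x. v + A *v x) | v A. True}"
    by blast
next
  fix u :: "real^2 \<Rightarrow> real^2" assume "u \<in> {on_set S (\<lambda>x. v + A *v x) | v A. True}"
  then show "u \<in> vec_polys 1 S"
    unfolding vec_polys_def polys_1
    by (clarsimp simp: on_set_nth matrix_vector_mul_component) blast
qed

lemma RT_0: "RT 0 S = {on_set S (\<lambda>x. v + e *\<^sub>R x) | v e. True}"
proof -
  have *: "on_set S (\<lambda>x. v) + (\<lambda>x. on_set S (\<lambda>x. e) x *\<^sub>R x) = on_set S (\<lambda>x. v + e *\<^sub>R x)"
    for v :: "real^2" and e
    by (auto simp: on_set_def fun_eq_iff)
  have "RT 0 S = {on_set S (\<lambda>x. v) + (\<lambda>x. on_set S (\<lambda>x. e) x *\<^sub>R x) | v e. True}"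
    unfolding RT_def vec_polys_0 hom_polys_0 by blast
  then show ?thesis
    unfolding * .
qed

lemma RT_1: "RT 1 S = {on_set S (\<lambda>x. v + A *v x + (l \<bullet> x) *\<^sub>R x) | v A l. True}"
proof -
  have *: "on_set S (\<lambda>x. v + A *v x) + (\<lambda>x. on_set S (\<lambda>x. l \<bullet> x) x *\<^sub>R x)
      = on_set S (\<lambda>x. v + A *v x + (l \<bullet> x) *\<^sub>R x)"
    for v l :: "real^2" and A :: "real^2^2"
    by (auto simp: on_set_def fun_eq_iff)
  have "RT 1 S = {on_set S (\<lambda>x. v + A *v x) + (\<lambda>x. on_set S (\<lambda>x. l \<bullet> x) x *\<^sub>R x) | v A l. True}"
    unfolding RT_def vec_polys_1 hom_polys_1 by blast
  then show ?thesis
    unfolding * .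
qed

text \<open>All entries of the fields below, and all their derivatives, are polynomials of degree at most
  three.  Listing the ten coefficients by degree reduces differentiation, addition and the
  comparison of fields to operations on the coefficients.\<close>

definition cubic :: "real \<Rightarrow> real \<Rightarrow> real \<Rightarrow> real \<Rightarrow> real \<Rightarrow> real \<Rightarrow> real \<Rightarrow> real \<Rightarrow> real \<Rightarrow> real
    \<Rightarrow> real^2 \<Rightarrow> real" where
  "cubic c00 c10 c01 c20 c11 c02 c30 c21 c12 c03 = (\<lambda>x. c00 + c10 * x $ 1 + c01 * x $ 2
      + c20 * (x $ 1)\<^sup>2 + c11 * x $ 1 * x $ 2 + c02 * (x $ 2)\<^sup>2
      + c30 * (x $ 1) ^ 3 + c21 * (x $ 1)\<^sup>2 * x $ 2 + c12 * x $ 1 * (x $ 2)\<^sup>2 + c03 * (x $ 2) ^ 3)"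

lemma cubic_add:
  "cubic a00 a10 a01 a20 a11 a02 a30 a21 a12 a03 x + cubic b00 b10 b01 b20 b11 b02 b30 b21 b12 b03 x =
   cubic (a00 + b00) (a10 + b10) (a01 + b01) (a20 + b20) (a11 + b11) (a02 + b02)
     (a30 + b30) (a21 + b21) (a12 + b12) (a03 + b03) x"
  by (simp add: cubic_def algebra_simps)

lemma sum_degree_le_3:
  fixes g :: "nat \<Rightarrow> nat \<Rightarrow> real"
  shows "(\<Sum>(i, j) \<in> {(i, j). i + j \<le> 3}. g i j) =
    (g 0 0 + g 0 1 + g 0 2 + g 0 3) + (g 1 0 + g 1 1 + g 1 2) + (g 2 0 + g 2 1) + g 3 0"
proof -
  have I: "{(i, j). i + j \<le> (3::nat)} = (SIGMA i:{..3}. {..3 - i})"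
    by auto
  have 3: "{..3} = {0, 1, 2, 3::nat}" "{..2} = {0, 1, 2::nat}" "{..1} = {0, 1::nat}"
    by auto
  have "(\<Sum>(i, j) \<in> {(i, j). i + j \<le> 3}. g i j) = (\<Sum>i\<le>3. \<Sum>j\<le>3 - i. g i j)"
    unfolding I by (rule sum.Sigma[symmetric]) auto
  also have "\<dots> = (\<Sum>j\<le>3. g 0 j) + (\<Sum>j\<le>2. g 1 j) + (\<Sum>j\<le>1. g 2 j) + g 3 0"
    by (simp add: 3(1) add.assoc)
  finally show ?thesis
    by (simp add: 3 add.assoc)
qed

lemma cubic_in_polys_3:
  "on_set S (cubic c00 c10 c01 c20 c11 c02 c30 c21 c12 c03) \<in> polys 3 S"
proof -
  define c :: "nat \<Rightarrow> nat \<Rightarrow> real" where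
    "c i j = (if i = 0 then if j = 0 then c00 else if j = 1 then c01 else if j = 2 then c02 else c03
      else if i = 1 then if j = 0 then c10 else if j = 1 then c11 else c12
      else if i = 2 then if j = 0 then c20 else c21 else c30)" for i j
  show ?thesis
    unfolding polys_def mem_Collect_eq sum_degree_le_3 cubic_def
    by (rule exI[of _ c], rule conjI[OF on_set_cong TrueI]) (simp add: c_def)
qed

lemma poly_zero_on_interval:
  fixes c :: "nat \<Rightarrow> real"
  assumes "a < b" and "\<And>s. a < s \<Longrightarrow> s < b \<Longrightarrow> (\<Sum>i\<le>n. c i * s ^ i) = 0" and "i \<le> n"
  shows "c i = 0"
proof (rule ccontr)
  assume "c i \<noteq> 0"
  then have "finite {s. (\<Sum>i\<le>n. c i * s ^ i) = 0}"
    using \<open>i \<le> n\<close> unfolding polyfun_finite_roots by blast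
  moreover have "{a<..<b} \<subseteq> {s. (\<Sum>i\<le>n. c i * s ^ i) = 0}"
    using assms(2) by auto
  ultimately have "finite {a<..<b}"
    by (rule rev_finite_subset)
  then show False
    using infinite_Ioo[OF \<open>a < b\<close>] by blast
qed

text \<open>An interior point of \<open>S\<close> is a corner of a small square inside \<open>S\<close>.  Fixing the second coordinate
  in that square leaves a polynomial in the first one that vanishes on an interval; so its
  coefficients, which are polynomials in the second coordinate, vanish on an interval too.\<close>

lemma bivariate_poly_zero:
  fixes c :: "nat \<Rightarrow> nat \<Rightarrow> real" and S :: "(real^2) set"
  assumes "interior S \<noteq> {}" and zero: "\<And>x. x \<in> S \<Longrightarrow> (\<Sum>i\<le>n. (\<Sum>j\<le>n. c i j * (x $ 2) ^ j) * (x $ 1) ^ i) = 0"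
    and "i \<le> n" "j \<le> n"
  shows "c i j = 0"
proof -
  obtain z e where "e > 0" and ball: "ball z e \<subseteq> S"
    using assms(1) by (metis ex_in_conv mem_interior)
  have box: "vector [s, t] \<in> S" if s: "z $ 1 < s" "s < z $ 1 + e / 2" and t: "z $ 2 < t" "t < z $ 2 + e / 2" for s t
  proof -
    have "norm (vector [s, t] - z) \<le> \<bar>s - z $ 1\<bar> + \<bar>t - z $ 2\<bar>"
      using norm_le_l1_cart[of "vector [s, t] - z"] by (simp add: sum_2)
    then have "vector [s, t] \<in> ball z e"
      using s t by (simp add: dist_norm norm_minus_commute)
    then show ?thesis
      using ball by blast
  qed
  have "(\<Sum>j\<le>n. c i j * t ^ j) = 0" if t: "z $ 2 < t" "t < z $ 2 + e / 2" for t
  proof (rule poly_zero_on_interval[of "z $ 1" "z $ 1 + e / 2" "\<lambda>i. \<Sum>j\<le>n. c i j * t ^ j" n])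
    fix s assume "z $ 1 < s" "s < z $ 1 + e / 2"
    then show "(\<Sum>i\<le>n. (\<Sum>j\<le>n. c i j * t ^ j) * s ^ i) = 0"
      using zero[OF box[OF _ _ t]] by simp
  qed (use \<open>e > 0\<close> \<open>i \<le> n\<close> in auto)
  then show ?thesis
    using poly_zero_on_interval[of "z $ 2" "z $ 2 + e / 2" "c i" n j] \<open>e > 0\<close> \<open>j \<le> n\<close> by simp
qed

lemma cubic_zero:
  assumes "interior S \<noteq> {}"
    and zero: "\<And>x. x \<in> S \<Longrightarrow> cubic c00 c10 c01 c20 c11 c02 c30 c21 c12 c03 x = 0"
  shows "c00 = 0" "c10 = 0" "c01 = 0" "c20 = 0" "c11 = 0" "c02 = 0" "c30 = 0" "c21 = 0" "c12 = 0" "c03 = 0"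
proof -
  define c :: "nat \<Rightarrow> nat \<Rightarrow> real" where
    "c i j = (if i = 0 then if j = 0 then c00 else if j = 1 then c01 else if j = 2 then c02 else c03
      else if i = 1 then if j = 0 then c10 else if j = 1 then c11 else if j = 2 then c12 else 0
      else if i = 2 then if j = 0 then c20 else if j = 1 then c21 else 0
      else if j = 0 then c30 else 0)" for i j
  have 3: "{..3} = {0, 1, 2, 3::nat}"
    by auto
  have "(\<Sum>i\<le>3. (\<Sum>j\<le>3. c i j * (x $ 2) ^ j) * (x $ 1) ^ i) = 0" if "x \<in> S" for x
    using zero[OF that] by (simp add: 3 c_def cubic_def algebra_simps)
  then have *: "c i j = 0" if "i \<le> 3" "j \<le> 3" for i j
    using bivariate_poly_zero[OF assms(1), of c 3 i j] that by blast
  show "c00 = 0" "c10 = 0" "c01 = 0" "c20 = 0" "c11 = 0" "c02 = 0" "c30 = 0" "c21 = 0" "c12 = 0" "c03 = 0"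
    using *[of 0 0] *[of 1 0] *[of 0 1] *[of 2 0] *[of 1 1] *[of 0 2] *[of 3 0] *[of 2 1] *[of 1 2] *[of 0 3]
    by (simp_all add: c_def)
qed

section \<open>A normal form for the fields of the tensor space\<close>

text \<open>The rows of \<open>P\<close> are the coefficients of the diagonal entries \<open>11\<close> and \<open>22\<close> and of the
  off-diagonal entry, so that \<open>P\<close> ranges over a space of dimension nine.\<close>

definition affine_sym :: "real^3^3 \<Rightarrow> real^2 \<Rightarrow> real^2^2" where
  "affine_sym P x = (let m = P *v vector [1, x $ 1, x $ 2] in
     vector [vector [m $ 1, m $ 3], vector [m $ 3, m $ 2]])"

definition sym_outer :: "real^2 \<Rightarrow> real^2 \<Rightarrow> real^2^2" where
  "sym_outer v w = (1/2) *\<^sub>R (outer v w + outer w v)"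

lemma sym_outer_entry: "sym_outer v w $ i $ j = (v $ i * w $ j + w $ i * v $ j) / 2"
  by (simp add: sym_outer_def outer_def)

lemma sym_outer_bilinear:
  "sym_outer (u + v) w = sym_outer u w + sym_outer v w"
  "sym_outer w (u + v) = sym_outer w u + sym_outer w v"
  "sym_outer (r *\<^sub>R v) w = r *\<^sub>R sym_outer v w"
  "sym_outer v (r *\<^sub>R w) = r *\<^sub>R sym_outer v w"
  by (simp_all add: vec_eq_iff sym_outer_entry algebra_simps add_divide_distrib)

lemma sym_outer_commute: "sym_outer v w = sym_outer w v"
  by (simp add: sym_outer_def add.commute)

lemma symm_outer: "symm (\<lambda>x. outer (\<phi> x) (\<psi> x)) = (\<lambda>x. sym_outer (\<phi> x) (\<psi> x))"
  by (simp add: symm_def sym_outer_def outer_def transpose_def vec_eq_iff fun_eq_iff mult.commute)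

lemma symm_outer_on_set:
  "symm (\<lambda>x. outer (on_set S \<phi> x) (on_set S \<psi> x)) = on_set S (\<lambda>x. sym_outer (\<phi> x) (\<psi> x))"
  unfolding symm_outer by (simp add: on_set_def fun_eq_iff sym_outer_entry vec_eq_iff)

lemma outer_mult_vec: "outer v l *v x = (l \<bullet> x) *\<^sub>R v"
  by (simp add: vec_eq_iff outer_def matrix_vector_mult_def sum_2 inner_vec_def algebra_simps)

text \<open>A congruence acts on a product of vector fields by acting on both factors.  This is why the
  matrix part of the Piola--Kirchhoff transformation respects the tensor product.\<close>

lemma sym_outer_congruence: "A ** sym_outer v w ** transpose A = sym_outer (A *v v) (A *v w)"
  by (simp add: vec_eq_iff sym_outer_entry matrix_matrix_mult_def matrix_vector_mult_def
      transpose_def sum_2 algebra_simps add_divide_distrib)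

text \<open>The normal form \<open>L(x) + sym(x (C x)\<^sup>T) + (l \<bullet> x) x x\<^sup>T\<close> with an affine \<open>L\<close>.  The three parameters
  live in spaces of dimension nine, four and two.\<close>

definition X_field :: "(real^3^3) \<times> (real^2^2) \<times> (real^2) \<Rightarrow> real^2 \<Rightarrow> real^2^2" where
  "X_field = (\<lambda>(P, C, l) x. affine_sym P x + sym_outer x (C *v x) + (l \<bullet> x) *\<^sub>R sym_outer x x)"

lemma X_field_entries:
  "X_field (P, C, l) x $ 1 $ 1 = P$1$1 + P$1$2 * x$1 + P$1$3 * x$2
     + x$1 * (C$1$1 * x$1 + C$1$2 * x$2) + x$1 * x$1 * (l$1 * x$1 + l$2 * x$2)"
  "X_field (P, C, l) x $ 2 $ 2 = P$2$1 + P$2$2 * x$1 + P$2$3 * x$2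
     + x$2 * (C$2$1 * x$1 + C$2$2 * x$2) + x$2 * x$2 * (l$1 * x$1 + l$2 * x$2)"
  "X_field (P, C, l) x $ 1 $ 2 = P$3$1 + P$3$2 * x$1 + P$3$3 * x$2
     + (x$1 * (C$2$1 * x$1 + C$2$2 * x$2) + x$2 * (C$1$1 * x$1 + C$1$2 * x$2)) / 2
     + x$1 * x$2 * (l$1 * x$1 + l$2 * x$2)"
  "X_field (P, C, l) x $ 2 $ 1 = P$3$1 + P$3$2 * x$1 + P$3$3 * x$2
     + (x$1 * (C$2$1 * x$1 + C$2$2 * x$2) + x$2 * (C$1$1 * x$1 + C$1$2 * x$2)) / 2
     + x$1 * x$2 * (l$1 * x$1 + l$2 * x$2)"
  by (simp_all add: X_field_def affine_sym_def sym_outer_entry Let_def matrix_vector_mult_def sum_2 sum_3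
      inner_vec_def field_simps)

lemma X_field_cubic:
  "(\<lambda>x. X_field (P, C, l) x $ 1 $ 1) =
     cubic (P$1$1) (P$1$2) (P$1$3) (C$1$1) (C$1$2) 0 (l$1) (l$2) 0 0"
  "(\<lambda>x. X_field (P, C, l) x $ 2 $ 2) =
     cubic (P$2$1) (P$2$2) (P$2$3) 0 (C$2$1) (C$2$2) 0 0 (l$1) (l$2)"
  "(\<lambda>x. X_field (P, C, l) x $ 1 $ 2) =
     cubic (P$3$1) (P$3$2) (P$3$3) (C$2$1 / 2) ((C$1$1 + C$2$2) / 2) (C$1$2 / 2) 0 (l$1) (l$2) 0"
  "(\<lambda>x. X_field (P, C, l) x $ 2 $ 1) =
     cubic (P$3$1) (P$3$2) (P$3$3) (C$2$1 / 2) ((C$1$1 + C$2$2) / 2) (C$1$2 / 2) 0 (l$1) (l$2) 0"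
  by (simp_all add: fun_eq_iff X_field_entries cubic_def power2_eq_square power3_eq_cube
      algebra_simps add_divide_distrib)

lemma X_field_sym: "transpose (X_field p x) = X_field p x"
  by (cases p) (simp add: vec_eq_iff forall_2 transpose_def X_field_entries)

lemma symmetric_matrix_eqI:
  fixes M N :: "real^2^2"
  assumes "transpose M = M" "transpose N = N"
    and "M $ 1 $ 1 = N $ 1 $ 1" "M $ 2 $ 2 = N $ 2 $ 2" "M $ 1 $ 2 = N $ 1 $ 2"
  shows "M = N"
proof -
  have "M $ 2 $ 1 = transpose M $ 1 $ 2" "N $ 2 $ 1 = transpose N $ 1 $ 2"
    by (simp_all add: transpose_def)
  then show ?thesis
    using assms by (simp add: vec_eq_iff forall_2)
qed

lemma linear_X_field: "linear (\<lambda>p. on_set S (X_field p))"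
proof (rule linearI)
  fix p q :: "(real^3^3) \<times> (real^2^2) \<times> (real^2)"
  have "X_field (p + q) x = X_field p x + X_field q x" for x
    by (cases p; cases q) (simp add: vec_eq_iff forall_2 X_field_entries algebra_simps add_divide_distrib)
  then show "on_set S (X_field (p + q)) = on_set S (X_field p) + on_set S (X_field q)"
    unfolding on_set_add by (intro on_set_cong)
next
  fix r :: real and p :: "(real^3^3) \<times> (real^2^2) \<times> (real^2)"
  have "X_field (r *\<^sub>R p) x = r *\<^sub>R X_field p x" for x
    by (cases p) (simp add: vec_eq_iff forall_2 X_field_entries algebra_simps
        del: mult_cancel_left mult_cancel_right)
  then show "on_set S (X_field (r *\<^sub>R p)) = r *\<^sub>R on_set S (X_field p)"
    unfolding on_set_scaleR by (intro on_set_cong)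
qed

lemma linear_symm: "linear symm"
  by (rule linearI)
    (simp_all add: symm_def fun_eq_iff plus_fun_def scaleR_fun_def vec_eq_iff transpose_def algebra_simps)

lemma X_tri_eq_span:
  "X_tri S = span {symm (\<lambda>x. outer (\<phi> x) (\<psi> x)) | \<phi> \<psi>. \<phi> \<in> RT 0 S \<and> \<psi> \<in> RT 1 S}"
  unfolding X_tri_def tensor_span_def
  by (subst linear_span_image[OF linear_symm, symmetric]) (rule arg_cong[of _ _ span]; blast)

lemma subspace_X_tri: "subspace (X_tri S)"
  unfolding X_tri_eq_span by (rule subspace_span)

text \<open>Expanding \<open>(v + e x) (w + A x + (l \<bullet> x) x)\<^sup>T\<close>, the terms of degree at most one are affine,
  those of degree two are \<open>x (e A x)\<^sup>T\<close> and \<open>(l \<bullet> x) v x\<^sup>T = (v l\<^sup>T x) x\<^sup>T\<close>, and the cubic term is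
  \<open>e (l \<bullet> x) x x\<^sup>T\<close>.\<close>

lemma symm_outer_RT:
  assumes "\<phi> \<in> RT 0 S" "\<psi> \<in> RT 1 S"
  shows "\<exists>p. symm (\<lambda>x. outer (\<phi> x) (\<psi> x)) = on_set S (X_field p)"
proof -
  obtain v e where \<phi>: "\<phi> = on_set S (\<lambda>x. v + e *\<^sub>R x)"
    using assms(1) unfolding RT_0 by blast
  obtain w A l where \<psi>: "\<psi> = on_set S (\<lambda>x. w + A *v x + (l \<bullet> x) *\<^sub>R x)"
    using assms(2) unfolding RT_1 by blast
  define P :: "real^3^3" where "P = vector
    [vector [v$1 * w$1, v$1 * A$1$1 + e * w$1, v$1 * A$1$2],
     vector [v$2 * w$2, v$2 * A$2$1, v$2 * A$2$2 + e * w$2],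
     vector [(v$1 * w$2 + v$2 * w$1) / 2, (v$1 * A$2$1 + v$2 * A$1$1 + e * w$2) / 2,
             (v$1 * A$2$2 + v$2 * A$1$2 + e * w$1) / 2]]"
  have P: "affine_sym P x = sym_outer v w + sym_outer v (A *v x) + e *\<^sub>R sym_outer x w" for x
    by (simp add: vec_eq_iff forall_2 affine_sym_def sym_outer_entry P_def Let_def
        matrix_vector_mult_def sum_2 sum_3 field_simps)
  have "symm (\<lambda>x. outer (\<phi> x) (\<psi> x)) = on_set S (\<lambda>x. sym_outer (v + e *\<^sub>R x) (w + A *v x + (l \<bullet> x) *\<^sub>R x))"
    unfolding \<phi> \<psi> by (rule symm_outer_on_set)
  also have "\<dots> = on_set S (X_field (P, e *\<^sub>R A + outer v l, e *\<^sub>R l))"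
    by (rule on_set_cong)
      (simp add: X_field_def P sym_outer_bilinear matrix_vector_mult_add_rdistrib outer_mult_vec
        scaleR_matrix_vector_assoc[symmetric] sym_outer_commute[of _ v] algebra_simps)
  finally show ?thesis
    by blast
qed

text \<open>Three products suffice.  Two of them have the constant first factors \<open>axis 1 1\<close> and \<open>axis 2 1\<close> and
  the rows of the affine part as second factors; the symmetrization halves the off-diagonal entry
  in each of them, and the two halves add up.  The product with first factor \<open>x\<close> gives all terms
  of higher degree.\<close>

lemma X_field_in_X_tri: "on_set S (X_field p) \<in> X_tri S"
proof -
  obtain P C l where p: "p = (P, C, l)"
    by (cases p)
  have gen: "on_set S (\<lambda>x. sym_outer (v + e *\<^sub>R x) (w + A *v x + (l \<bullet> x) *\<^sub>R x)) \<in> X_tri S"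
    for v w e A l
  proof -
    have "on_set S (\<lambda>x. sym_outer (v + e *\<^sub>R x) (w + A *v x + (l \<bullet> x) *\<^sub>R x)) =
      symm (\<lambda>x. outer (on_set S (\<lambda>x. v + e *\<^sub>R x) x) (on_set S (\<lambda>x. w + A *v x + (l \<bullet> x) *\<^sub>R x) x))"
      by (rule symm_outer_on_set[symmetric])
    then show ?thesis
      unfolding X_tri_eq_span RT_0 RT_1 by (intro span_base) blast
  qed
  define w1 w2 :: "real^2" where "w1 = vector [P$1$1, P$3$1]" and "w2 = vector [P$3$1, P$2$1]"
  define A1 A2 :: "real^2^2" where "A1 = vector [vector [P$1$2, P$1$3], vector [P$3$2, P$3$3]]"
    and "A2 = vector [vector [P$3$2, P$3$3], vector [P$2$2, P$2$3]]"
  have P: "affine_sym P x = sym_outer (axis 1 1) (w1 + A1 *v x) + sym_outer (axis 2 1) (w2 + A2 *v x)" for x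
    by (simp add: vec_eq_iff forall_2 affine_sym_def sym_outer_entry w1_def w2_def A1_def A2_def Let_def
        matrix_vector_mult_def sum_2 sum_3 axis_def field_simps)
  have "on_set S (X_field p) =
      on_set S (\<lambda>x. sym_outer (axis 1 1 + 0 *\<^sub>R x) (w1 + A1 *v x + (0 \<bullet> x) *\<^sub>R x))
      + on_set S (\<lambda>x. sym_outer (axis 2 1 + 0 *\<^sub>R x) (w2 + A2 *v x + (0 \<bullet> x) *\<^sub>R x))
      + on_set S (\<lambda>x. sym_outer (0 + 1 *\<^sub>R x) (0 + C *v x + (l \<bullet> x) *\<^sub>R x))"
    unfolding on_set_add by (rule on_set_cong) (simp add: p X_field_def P sym_outer_bilinear)
  also have "\<dots> \<in> X_tri S"
    by (intro subspace_add[OF subspace_X_tri] gen)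
  finally show ?thesis .
qed

lemma X_tri_eq: "X_tri S = range (\<lambda>p. on_set S (X_field p))"
proof
  show "range (\<lambda>p. on_set S (X_field p)) \<subseteq> X_tri S"
    using X_field_in_X_tri by blast
  have "subspace (range (\<lambda>p. on_set S (X_field p)))"
    by (rule linear_subspace_image[OF linear_X_field subspace_UNIV])
  then show "X_tri S \<subseteq> range (\<lambda>p. on_set S (X_field p))"
    unfolding X_tri_eq_span using symm_outer_RT by (intro span_minimal) blast+
qed

text \<open>The diagonal entries determine \<open>C\<close>, \<open>l\<close> and the first two rows of \<open>P\<close>, the entry \<open>12\<close> the third
  row.\<close>

lemma X_field_eq_0:
  assumes "interior S \<noteq> {}" and "on_set S (X_field p) = 0"
  shows "p = 0"
proof -
  obtain P C l where p: "p = (P, C, l)"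
    by (cases p)
  have 0: "X_field (P, C, l) x $ i $ j = 0" if "x \<in> S" for x i j
    using fun_cong[OF assms(2), of x] that by (simp add: p on_set_def)
  note z11 = cubic_zero[OF assms(1) 0[of _ 1 1, unfolded fun_cong[OF X_field_cubic(1)]]]
  note z22 = cubic_zero[OF assms(1) 0[of _ 2 2, unfolded fun_cong[OF X_field_cubic(2)]]]
  note z12 = cubic_zero[OF assms(1) 0[of _ 1 2, unfolded fun_cong[OF X_field_cubic(3)]]]
  have "P = 0" "C = 0" "l = 0"
    using z11 z22 z12 by (simp_all add: vec_eq_iff forall_2 forall_3)
  then show ?thesis
    by (simp add: p zero_prod_def)
qed

lemma inj_X_field:
  assumes "interior S \<noteq> {}"
  shows "inj (\<lambda>p. on_set S (X_field p))"
  using X_field_eq_0[OF assms] by (simp add: linear_injective_0[OF linear_X_field])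

lemma dim_range_linear:
  fixes f :: "'a::euclidean_space \<Rightarrow> 'b::real_vector"
  assumes "linear f" "inj f"
  shows "dim (range f) = DIM('a)"
proof -
  have "independent (f ` Basis)"
    using assms independent_Basis by (intro linear_independent_injective_image) (auto intro: inj_on_subset)
  moreover have "span (f ` Basis) = span (range f)"
    unfolding linear_span_image[OF assms(1)] by simp
  moreover have "card (f ` Basis) = DIM('a)"
    using assms(2) by (intro card_image) (auto intro: inj_on_subset)
  ultimately show ?thesis
    using dim_eq_card by metis
qed

text \<open>The fifteen is \<open>3 \<cdot> 3 + 2 \<cdot> 2 + 2\<close>, the dimension of the parameter space.\<close>

lemma dim_X_tri:
  assumes "interior S \<noteq> {}"
  shows "dim (X_tri S) = 15"
  unfolding X_tri_eq dim_range_linear[OF linear_X_field inj_X_field[OF assms]]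
  by simp

lemma X_tri_cubic: "X_tri S \<subseteq> sym_polys 3 S"
proof
  fix M assume "M \<in> X_tri S"
  then obtain P C l where M: "M = on_set S (X_field (P, C, l))"
    unfolding X_tri_eq by (metis imageE prod_cases3)
  have "(\<lambda>x. M x $ i $ j) \<in> polys 3 S" for i j
    using exhaust_2[of i] exhaust_2[of j] unfolding M on_set_nth_nth
    by (auto simp: X_field_cubic cubic_in_polys_3)
  moreover have "transpose (M x) = M x" for x
    by (simp add: M on_set_def X_field_sym) (simp add: transpose_def vec_eq_iff)
  ultimately show "M \<in> sym_polys 3 S"
    by (simp add: sym_polys_def)
qed

section \<open>Invariance under the Piola--Kirchhoff transformation\<close>

text \<open>\<open>A\<close> is the linear part of the inverse of the affine map \<open>H\<close>.  It turns the radial field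
  \<open>H y\<close> into \<open>y - g\<close>, which is again radial up to a constant.\<close>

lemma RT_0_affine:
  assumes "\<phi> \<in> RT 0 S" and "\<And>y. y \<in> T \<Longrightarrow> H y \<in> S" and "\<And>y. y \<in> T \<Longrightarrow> A *v H y = y - g"
  shows "on_set T (\<lambda>y. A *v \<phi> (H y)) \<in> RT 0 T"
proof -
  obtain v e where \<phi>: "\<phi> = on_set S (\<lambda>x. v + e *\<^sub>R x)"
    using assms(1) unfolding RT_0 by blast
  have "on_set T (\<lambda>y. A *v \<phi> (H y)) = on_set T (\<lambda>y. (A *v v - e *\<^sub>R g) + e *\<^sub>R y)"
    by (rule on_set_cong)
      (simp add: \<phi> on_set_def assms(2,3) matrix_vector_right_distrib matrix_vector_mult_scaleR scaleR_right_diff_distrib)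
  then show ?thesis
    unfolding RT_0 by blast
qed

text \<open>The radial term \<open>(l \<bullet> H y) H y\<close> becomes \<open>(l \<bullet> H y) (y - g)\<close>.  Its only quadratic part is
  \<open>(l \<bullet> A' y) y\<close>, again a linear form times \<open>y\<close>; everything else is affine and is absorbed by the
  full polynomial part.\<close>

lemma RT_1_affine:
  assumes "\<psi> \<in> RT 1 S" and "\<And>y. y \<in> T \<Longrightarrow> H y \<in> S" and "\<And>y. y \<in> T \<Longrightarrow> A *v H y = y - g"
    and "\<And>y. H y = A' *v y + h"
  shows "on_set T (\<lambda>y. A *v \<psi> (H y)) \<in> RT 1 T"
proof -
  obtain w C l where \<psi>: "\<psi> = on_set S (\<lambda>x. w + C *v x + (l \<bullet> x) *\<^sub>R x)"
    using assms(1) unfolding RT_1 by blast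
  define w' where "w' = A *v w + A *v (C *v h) - (l \<bullet> h) *\<^sub>R g"
  define C' where "C' = A ** C ** A' + (l \<bullet> h) *\<^sub>R mat 1 - outer g (l v* A')"
  have "on_set T (\<lambda>y. A *v \<psi> (H y)) = on_set T (\<lambda>y. w' + C' *v y + ((l v* A') \<bullet> y) *\<^sub>R y)"
  proof (rule on_set_cong)
    fix y assume y: "y \<in> T"
    have lH: "l \<bullet> H y = (l v* A') \<bullet> y + l \<bullet> h"
      by (simp add: assms(4) inner_add_right dot_lmul_matrix)
    have "A *v \<psi> (H y) = A *v w + A *v (C *v H y) + (l \<bullet> H y) *\<^sub>R (y - g)"
      using y by (simp add: \<psi> on_set_def assms(2) matrix_vector_right_distrib matrix_vector_mult_scaleR
          flip: assms(3))
    also have "A *v (C *v H y) = (A ** C ** A') *v y + A *v (C *v h)"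
      by (simp add: assms(4) matrix_vector_right_distrib matrix_vector_mul_assoc matrix_mul_assoc)
    finally show "A *v \<psi> (H y) = w' + C' *v y + ((l v* A') \<bullet> y) *\<^sub>R y"
      by (simp add: lH w'_def C'_def outer_mult_vec matrix_vector_mult_add_rdistrib matrix_vector_mult_diff_rdistrib
          scaleR_matrix_vector_assoc[symmetric] algebra_simps)
  qed
  then show ?thesis
    unfolding RT_1 by blast
qed

lemma X_tri_affine:
  assumes "M \<in> X_tri S" and "\<And>y. y \<in> T \<Longrightarrow> H y \<in> S" and "\<And>y. y \<in> T \<Longrightarrow> A *v H y = y - g"
    and "\<And>y. H y = A' *v y + h"
  shows "on_set T (\<lambda>y. r *\<^sub>R (A ** M (H y) ** transpose A)) \<in> X_tri T"
proof -
  define \<Psi> where "\<Psi> M = on_set T (\<lambda>y. r *\<^sub>R (A ** M (H y) ** transpose A))" 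
    for M :: "real^2 \<Rightarrow> real^2^2"
  have "linear \<Psi>"
    by (rule linearI) (simp_all add: \<Psi>_def fun_eq_iff on_set_def plus_fun_def scaleR_fun_def vec_eq_iff
        forall_2 matrix_matrix_mult_def sum_2 transpose_def algebra_simps)
  have gen: "\<Psi> (symm (\<lambda>x. outer (\<phi> x) (\<psi> x))) \<in> X_tri T" if "\<phi> \<in> RT 0 S" "\<psi> \<in> RT 1 S" for \<phi> \<psi>
  proof -
    define \<phi>' where "\<phi>' = on_set T (\<lambda>y. A *v \<phi> (H y))"
    define \<psi>' where "\<psi>' = on_set T (\<lambda>y. A *v \<psi> (H y))"
    have "\<phi>' \<in> RT 0 T" "\<psi>' \<in> RT 1 T"
      unfolding \<phi>'_def \<psi>'_def using that assms by (blast intro: RT_0_affine RT_1_affine)+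
    then have "r *\<^sub>R symm (\<lambda>x. outer (\<phi>' x) (\<psi>' x)) \<in> X_tri T"
      unfolding X_tri_eq_span by (intro span_scale span_base) blast
    moreover have "\<Psi> (symm (\<lambda>x. outer (\<phi> x) (\<psi> x))) = r *\<^sub>R symm (\<lambda>x. outer (\<phi>' x) (\<psi>' x))"
      unfolding \<phi>'_def \<psi>'_def symm_outer_on_set
      by (simp add: \<Psi>_def symm_outer sym_outer_congruence on_set_scaleR)
    ultimately show ?thesis
      by simp
  qed
  have "\<Psi> ` X_tri S \<subseteq> X_tri T"
    unfolding X_tri_eq_span[of S] linear_span_image[OF \<open>linear \<Psi>\<close>, symmetric]
    using gen by (intro span_minimal subspace_X_tri) blast
  then show ?thesis
    using assms(1) unfolding \<Psi>_def by blast
qed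

text \<open>Both directions are instances of the same invariance: the inverse of the transformation has the
  same form, with the inverse matrix and the inverse affine map.\<close>

lemma piola_X_tri_iff:
  assumes pos: "pos_triangle a b c" and "sym_field ref_triangle Mh"
  shows "Mh \<in> X_tri ref_triangle \<longleftrightarrow> piola a b c Mh \<in> X_tri (triangle_of a b c)"
proof -
  define B where "B = B_mat a b c"
  define K where "K = triangle_of a b c"
  define B' where "B' = matrix_inv B"
  have det: "det B > 0"
    using pos by (simp add: pos_triangle_def B_def)
  then have "invertible B"
    by (simp add: invertible_det_nz)
  then have inv: "B ** B' = mat 1" "B' ** B = mat 1"
    unfolding B'_def invertible_def matrix_inv_def by (metis (mono_tags, lifting) someI_ex)+
  have invv: "B *v (B' *v y) = y" "B' *v (B *v y) = y" for y
    by (simp_all add: matrix_vector_mul_assoc inv)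
  define H where "H y = B' *v y + (- (B' *v a))" for y
  have F: "F_map a b c x = B *v x + a" for x
    by (simp add: F_map_def B_def)
  have HF: "H (F_map a b c x) = x" for x
    by (simp add: H_def F matrix_vector_right_distrib invv)
  have K: "K = F_map a b c ` ref_triangle"
    by (simp add: K_def F_map_image_ref_triangle)
  have H: "H y \<in> ref_triangle" if "y \<in> K" for y
    using that HF by (auto simp: K)
  have piola: "piola a b c Mh = on_set K (\<lambda>y. (1 / det B) *\<^sub>R (B ** Mh (H y) ** transpose B))"
    unfolding piola_def K_def[symmetric] B_def[symmetric]
  proof (rule on_set_cong)
    fix y assume "y \<in> K"
    then obtain x where x: "x \<in> ref_triangle" "y = F_map a b c x"
      by (auto simp: K)
    have "the_inv_into ref_triangle (F_map a b c) y = x"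
      unfolding x(2) using inj_F_map[OF pos] x(1) by (meson inj_on_subset subset_UNIV the_inv_into_f_f)
    then show "(1 / det B) *\<^sub>R (B ** Mh (the_inv_into ref_triangle (F_map a b c) y) ** transpose B) =
      (1 / det B) *\<^sub>R (B ** Mh (H y) ** transpose B)"
      by (simp add: x(2) HF)
  qed
  show ?thesis
    unfolding K_def[symmetric]
  proof
    assume "Mh \<in> X_tri ref_triangle"
    then show "piola a b c Mh \<in> X_tri K"
      unfolding piola
    proof (rule X_tri_affine)
      show "H y = B' *v y + (- (B' *v a))" for y
        by (simp add: H_def)
      show "B *v H y = y - a" for y
        by (simp add: H_def matrix_vector_mult_diff_distrib invv)
    qed (rule H)
  next
    assume "piola a b c Mh \<in> X_tri K"
    then have "on_set ref_triangle (\<lambda>x. det B *\<^sub>R (B' ** piola a b c Mh (F_map a b c x) ** transpose B'))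
      \<in> X_tri ref_triangle"
    proof (rule X_tri_affine)
      show "F_map a b c x = B *v x + a" for x
        by (rule F)
      show "B' *v F_map a b c x = x - (- (B' *v a))" for x
        by (simp add: F matrix_vector_right_distrib invv)
    qed (simp add: K)
    also have "on_set ref_triangle (\<lambda>x. det B *\<^sub>R (B' ** piola a b c Mh (F_map a b c x) ** transpose B'))
      = on_set ref_triangle Mh"
    proof (rule on_set_cong)
      fix x assume x: "x \<in> ref_triangle"
      have "F_map a b c x \<in> K"
        using x by (simp add: K)
      then have "piola a b c Mh (F_map a b c x) = (1 / det B) *\<^sub>R (B ** Mh x ** transpose B)"
        by (simp add: piola on_set_def HF)
      then have "det B *\<^sub>R (B' ** piola a b c Mh (F_map a b c x) ** transpose B') =
        B' ** (B ** Mh x ** transpose B) ** transpose B'"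
        using det by (simp add: matrix_scalar_ac scalar_matrix_assoc[symmetric])
      also have "\<dots> = (B' ** B) ** Mh x ** transpose (B' ** B)"
        by (simp add: matrix_transpose_mul matrix_mul_assoc)
      finally show "det B *\<^sub>R (B' ** piola a b c Mh (F_map a b c x) ** transpose B') = Mh x"
        by (simp add: inv transpose_mat)
    qed
    also have "on_set ref_triangle Mh = Mh"
      using assms(2) by (simp add: sym_field_def)
    finally show "Mh \<in> X_tri ref_triangle" .
  qed
qed

section \<open>Partial derivatives on a triangle\<close>

lemma convex_triangle: "convex (triangle_of a b c)"
  by (simp add: triangle_of_def)

lemma interior_triangle_nonempty:
  assumes "pos_triangle a b c"
  shows "interior (triangle_of a b c) \<noteq> {}"
proof -
  have D: "(b - a) $ 1 * (c - a) $ 2 - (c - a) $ 1 * (b - a) $ 2 > 0"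
    using assms by (simp add: pos_triangle_def det_B_mat)
  have "\<not> collinear {a, b, c}"
  proof
    assume "collinear {a, b, c}"
    then obtain u where "b = u *\<^sub>R a + (1 - u) *\<^sub>R c"
      using D by (auto simp: collinear_3_expand)
    then have "b - a = (1 - u) *\<^sub>R (c - a)"
      by (simp add: algebra_simps)
    then show False
      using D by simp
  qed
  then have "\<not> affine_dependent {a, b, c}" "card {a, b, c} = Suc (DIM(real^2))"
    by (auto simp: collinear_3_eq_affine_dependent)
  then show ?thesis
    by (simp add: triangle_of_def interior_convex_hull_eq_empty)
qed

text \<open>A corner of \<open>K\<close> need not be the end point of a segment in \<open>K\<close> parallel to a given axis, so the derivative
  cannot be read off from difference quotients along the axes.  But difference quotients along
  the segments from \<open>x\<close> to the points \<open>y\<close> of \<open>K\<close> determine it on all vectors \<open>y - x\<close>, and the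
  differences of these vectors include a ball around zero.\<close>

lemma has_derivative_within_convex_unique:
  fixes f :: "'a::euclidean_space \<Rightarrow> 'b::real_normed_vector"
  assumes K: "convex K" "interior K \<noteq> {}" "x \<in> K"
    and D1: "(f has_derivative D1) (at x within K)"
    and D2: "(f has_derivative D2) (at x within K)"
  shows "D1 = D2"
proof
  interpret D1: bounded_linear D1
    using D1 by (rule has_derivative_bounded_linear)
  interpret D2: bounded_linear D2
    using D2 by (rule has_derivative_bounded_linear)
  have into_K: "D1 (y - x) = D2 (y - x)" if y: "y \<in> K" for y
  proof -
    define \<gamma> where "\<gamma> t = x + t *\<^sub>R (y - x)" for t
    have \<gamma>: "(\<gamma> has_vector_derivative (y - x)) (at 0 within {0..1})"
      unfolding \<gamma>_def by (auto intro!: derivative_eq_intros)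
    have sub: "\<gamma> ` {0..1} \<subseteq> K"
    proof clarify
      fix t :: real assume t: "t \<in> {0..1}"
      have "(1 - t) *\<^sub>R x + t *\<^sub>R y \<in> K"
        using K(1,3) y t by (intro convexD_alt) auto
      then show "\<gamma> t \<in> K"
        by (simp add: \<gamma>_def algebra_simps)
    qed
    have "((f \<circ> \<gamma>) has_vector_derivative D (y - x)) (at 0 within {0..1})"
      if "(f has_derivative D) (at x within K)" for D
    proof (rule vector_derivative_diff_chain_within[OF \<gamma>])
      have "\<gamma> 0 = x" by (simp add: \<gamma>_def)
      then show "(f has_derivative D) (at (\<gamma> 0) within \<gamma> ` {0..1})"
        using has_derivative_subset[OF that sub] by simp
    qed
    from this[OF D1] this[OF D2] show ?thesis
      by (intro vector_derivative_unique_within_closed_interval[of 0 1 0 "f \<circ> \<gamma>"]) auto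
  qed
  fix v :: 'a
  obtain z e where "e > 0" and ball: "ball z e \<subseteq> K"
    using K(2) by (metis ex_in_conv mem_interior)
  \<comment> \<open>The summand one keeps the denominator positive for \<open>v = 0\<close>.\<close>
  define s where "s = e / 2 / (norm v + 1)"
  have "s > 0"
    unfolding s_def using \<open>e > 0\<close> by (intro divide_pos_pos add_nonneg_pos) auto
  have "norm (s *\<^sub>R v) < e"
  proof -
    have "norm v + 1 > 0"
      by (simp add: add_nonneg_pos)
    then have "s * (norm v + 1) = e / 2"
      using nonzero_eq_divide_eq[of "norm v + 1" s "e / 2"] by (simp add: s_def)
    then show ?thesis
      using \<open>s > 0\<close> \<open>e > 0\<close> by (simp add: distrib_left)
  qed
  then have zv: "z + s *\<^sub>R v \<in> K" and z: "z \<in> K"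
    using ball \<open>e > 0\<close> by (auto simp: subset_eq dist_norm)
  have "D1 (s *\<^sub>R v) = D1 (z + s *\<^sub>R v - x) - D1 (z - x)"
    by (simp add: D1.diff D1.add)
  also have "\<dots> = D2 (z + s *\<^sub>R v - x) - D2 (z - x)"
    using into_K zv z by simp
  also have "\<dots> = D2 (s *\<^sub>R v)"
    by (simp add: D2.diff D2.add)
  finally show "D1 v = D2 v"
    using \<open>s > 0\<close> by (simp add: D1.scaleR D2.scaleR)
qed

lemma pd_on_set:
  assumes K: "convex K" "interior K \<noteq> {}"
    and f: "\<And>x. x \<in> K \<Longrightarrow> (f has_derivative D x) (at x)"
  shows "pd K i (on_set K f) = on_set K (\<lambda>x. D x (axis i 1))"
  unfolding pd_def
proof (rule on_set_cong)
  fix x assume x: "x \<in> K"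
  have D: "(on_set K f has_derivative D x) (at x within K)"
    using has_derivative_at_withinI[OF f[OF x]]
    by (rule has_derivative_transform[OF x, rotated]) (simp add: on_set_def)
  then have "(on_set K f has_derivative frechet_derivative (on_set K f) (at x within K)) (at x within K)"
    using frechet_derivative_works differentiable_def by blast
  then show "frechet_derivative (on_set K f) (at x within K) (axis i 1) = D x (axis i 1)"
    using has_derivative_within_convex_unique[OF K x _ D] by metis
qed

lemma pd_cubic:
  assumes K: "convex K" "interior K \<noteq> {}"
  shows "pd K 1 (on_set K (cubic c00 c10 c01 c20 c11 c02 c30 c21 c12 c03)) =
      on_set K (cubic c10 (2 * c20) c11 (3 * c30) (2 * c21) c12 0 0 0 0)"
    and "pd K 2 (on_set K (cubic c00 c10 c01 c20 c11 c02 c30 c21 c12 c03)) =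
      on_set K (cubic c01 c11 (2 * c02) c21 (2 * c12) (3 * c03) 0 0 0 0)"
proof -
  have coord: "((\<lambda>x. x $ i) has_derivative (\<lambda>h. h $ i)) (at x)" for i and x :: "real^2"
    by (rule bounded_linear_imp_has_derivative[OF bounded_linear_vec_nth])
  have D: "(cubic c00 c10 c01 c20 c11 c02 c30 c21 c12 c03 has_derivative
      (\<lambda>h. cubic c10 (2 * c20) c11 (3 * c30) (2 * c21) c12 0 0 0 0 x * h $ 1
         + cubic c01 c11 (2 * c02) c21 (2 * c12) (3 * c03) 0 0 0 0 x * h $ 2)) (at x)" for x
    unfolding cubic_def
    by (rule derivative_eq_intros coord refl)+
      (simp add: fun_eq_iff power2_eq_square algebra_simps)
  show "pd K 1 (on_set K (cubic c00 c10 c01 c20 c11 c02 c30 c21 c12 c03)) =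
      on_set K (cubic c10 (2 * c20) c11 (3 * c30) (2 * c21) c12 0 0 0 0)"
    "pd K 2 (on_set K (cubic c00 c10 c01 c20 c11 c02 c30 c21 c12 c03)) =
      on_set K (cubic c01 c11 (2 * c02) c21 (2 * c12) (3 * c03) 0 0 0 0)"
    unfolding pd_on_set[OF K D] by (simp_all add: axis_def)
qed

section \<open>The direct decomposition\<close>

lemma is_direct_sum3_image:
  fixes f :: "'a::real_vector \<Rightarrow> 'b::real_vector"
  assumes f: "linear f" "inj f" and sum: "is_direct_sum3 W U1 U2 U3"
  shows "is_direct_sum3 (f ` W) (f ` U1) (f ` U2) (f ` U3)"
proof -
  have sub: "subspace U1" "subspace U2" "subspace U3"
    and bij: "bij_betw (\<lambda>(u1, u2, u3). u1 + u2 + u3) (U1 \<times> U2 \<times> U3) W"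
    using sum by (auto simp: is_direct_sum3_def)
  define \<sigma> :: "'a \<times> 'a \<times> 'a \<Rightarrow> 'a" where "\<sigma> = (\<lambda>(u1, u2, u3). u1 + u2 + u3)"
  define \<tau> :: "'b \<times> 'b \<times> 'b \<Rightarrow> 'b" where "\<tau> = (\<lambda>(u1, u2, u3). u1 + u2 + u3)"
  define F where "F = map_prod f (map_prod f f)"
  have comm: "\<tau> \<circ> F = f \<circ> \<sigma>"
    using f(1) by (auto simp: \<tau>_def \<sigma>_def F_def linear_add)
  have F: "F ` (U1 \<times> U2 \<times> U3) = f ` U1 \<times> f ` U2 \<times> f ` U3"
    by (simp add: F_def map_prod_surj_on)
  have \<sigma>: "bij_betw \<sigma> (U1 \<times> U2 \<times> U3) W"
    using bij by (simp add: \<sigma>_def)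
  have "inj_on (f \<circ> \<sigma>) (U1 \<times> U2 \<times> U3)"
    using bij_betw_imp_inj_on[OF \<sigma>] f(2) by (meson comp_inj_on inj_on_subset subset_UNIV)
  then have "inj_on \<tau> (F ` (U1 \<times> U2 \<times> U3))"
    unfolding comm[symmetric] by (rule inj_on_imageI)
  moreover have "\<tau> ` F ` (U1 \<times> U2 \<times> U3) = f ` \<sigma> ` (U1 \<times> U2 \<times> U3)"
    by (simp only: image_comp comm)
  ultimately have "bij_betw \<tau> (f ` U1 \<times> f ` U2 \<times> f ` U3) (f ` W)"
    using \<sigma> by (simp add: F bij_betw_def)
  then show ?thesis
    using sub f(1) by (simp add: is_direct_sum3_def \<tau>_def linear_subspace_image)
qed

text \<open>The decomposition of fields comes from splitting the matrix \<open>C\<close> of the normal form into a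
  trace-free matrix and a multiple of the identity; the latter goes together with \<open>l\<close>.\<close>

lemma parameter_direct_sum:
  "is_direct_sum3 (UNIV :: ((real^3^3) \<times> (real^2^2) \<times> (real^2)) set)
     {(P, 0, 0) | P. True} {(0, C, 0) | C. trace C = 0} {(0, \<kappa> *\<^sub>R mat 1, l) | \<kappa> l. True}"
proof -
  have tr: "trace (C + D) = trace C + trace D" "trace (r *\<^sub>R C) = r * trace C" "trace (0 :: real^2^2) = 0"
    "trace (mat 1 :: real^2^2) = 2"
    for C D :: "real^2^2" and r
    by (simp_all add: trace_def sum_2 algebra_simps mat_def)
  have "subspace {(P, 0, 0) :: (real^3^3) \<times> (real^2^2) \<times> (real^2) | P. True}"
    by (auto simp: subspace_def zero_prod_def)
  moreover have "subspace {(0, C, 0) :: (real^3^3) \<times> (real^2^2) \<times> (real^2) | C. trace C = 0}"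
    by (auto simp: subspace_def zero_prod_def tr)
  moreover have "subspace {(0, \<kappa> *\<^sub>R mat 1, l) :: (real^3^3) \<times> (real^2^2) \<times> (real^2) | \<kappa> l. True}"
    by (auto simp: subspace_def zero_prod_def scaleR_left_distrib[symmetric] intro: exI[of _ 0])
  moreover have "bij_betw (\<lambda>(u1, u2, u3). u1 + u2 + u3)
     ({(P, 0, 0) | P. True} \<times> {(0, C, 0) | C. trace C = 0} \<times> {(0, \<kappa> *\<^sub>R mat 1, l) | \<kappa> l. True})
     (UNIV :: ((real^3^3) \<times> (real^2^2) \<times> (real^2)) set)"
    by (rule bij_betwI[where g = "\<lambda>(P, C, l). ((P, 0, 0),
        (0, C - (trace C / 2) *\<^sub>R mat 1, 0), (0, (trace C / 2) *\<^sub>R mat 1, l))"])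
      (auto simp: tr trace_sub)
  ultimately show ?thesis
    unfolding is_direct_sum3_def by blast
qed

lemma sym_polys_1: "sym_polys 1 S = (\<lambda>p. on_set S (X_field p)) ` {(P, 0, 0) | P. True}"
proof
  show "sym_polys 1 S \<subseteq> (\<lambda>p. on_set S (X_field p)) ` {(P, 0, 0) | P. True}"
  proof
    fix M assume M: "M \<in> sym_polys 1 S"
    then obtain \<alpha> k where entry: "\<And>i j. (\<lambda>x. M x $ i $ j) = on_set S (\<lambda>x. \<alpha> i j + k i j \<bullet> x)"
      unfolding sym_polys_def polys_1 mem_Collect_eq simp_thms by metis
    have sym: "transpose (M x) = M x" for x
      using M by (simp add: sym_polys_def)
    define row where "row i j = (vector [\<alpha> i j, k i j $ 1, k i j $ 2] :: real^3)" for i j :: 2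
    define P :: "real^3^3" where "P = vector [row 1 1, row 2 2, row 1 2]"
    have "M = on_set S (X_field (P, 0, 0))"
    proof
      fix x
      have e: "M x $ i $ j = (if x \<in> S then \<alpha> i j + k i j \<bullet> x else 0)" for i j
        using fun_cong[OF entry[of i j], of x] by (simp add: on_set_def)
      show "M x = on_set S (X_field (P, 0, 0)) x"
        by (rule symmetric_matrix_eqI)
          (simp_all add: sym e on_set_def X_field_sym X_field_entries P_def row_def inner_vec_def sum_2,
           simp add: transpose_def vec_eq_iff)
    qed
    then show "M \<in> (\<lambda>p. on_set S (X_field p)) ` {(P, 0, 0) | P. True}"
      by blast
  qed
  show "(\<lambda>p. on_set S (X_field p)) ` {(P, 0, 0) | P. True} \<subseteq> sym_polys 1 S"
  proof clarify
    fix P :: "real^3^3"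
    have aff: "on_set S (\<lambda>x. q $ 1 + q $ 2 * x $ 1 + q $ 3 * x $ 2) \<in> polys 1 S" for q :: "real^3"
    proof -
      have "on_set S (\<lambda>x. q $ 1 + q $ 2 * x $ 1 + q $ 3 * x $ 2) = on_set S (\<lambda>x. q $ 1 + vector [q $ 2, q $ 3] \<bullet> x)"
        by (rule on_set_cong) (simp add: inner_vec_def sum_2 add.assoc)
      then show ?thesis
        unfolding polys_1 by blast
    qed
    have entries: "on_set S (\<lambda>x. X_field (P, 0, 0) x $ i $ j) \<in> polys 1 S" for i j
      using exhaust_2[of i] exhaust_2[of j] by (auto simp: X_field_entries aff simp del: One_nat_def)
    have "transpose (on_set S (X_field (P, 0, 0)) x) = on_set S (X_field (P, 0, 0)) x" for x
      by (simp add: on_set_def X_field_sym) (simp add: transpose_def vec_eq_iff)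
    then show "on_set S (X_field (P, 0, 0)) \<in> sym_polys 1 S"
      by (simp add: sym_polys_def on_set_nth_nth entries del: One_nat_def)
  qed
qed

text \<open>For \<open>C = \<kappa> I\<close> the quadratic part of the normal form is \<open>\<kappa> x x\<^sup>T\<close>.\<close>

lemma xxT_P1_eq: "xxT_P1 S = (\<lambda>p. on_set S (X_field p)) ` {(0, \<kappa> *\<^sub>R mat 1, l) | \<kappa> l. True}"
proof -
  have xx: "sym_outer x x = outer x x" for x
    by (simp add: vec_eq_iff sym_outer_entry outer_def)
  have "affine_sym 0 x = 0" for x
    by (simp add: affine_sym_def Let_def vec_eq_iff forall_2)
  then have "(\<lambda>x. on_set S (\<lambda>x. \<kappa> + l \<bullet> x) x *\<^sub>R outer x x) = on_set S (X_field (0, \<kappa> *\<^sub>R mat 1, l))" for \<kappa> l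
    by (auto simp: on_set_def fun_eq_iff X_field_def xx scaleR_left_distrib sym_outer_bilinear
        scaleR_matrix_vector_assoc[symmetric])
  then show ?thesis
    unfolding xxT_P1_def polys_1 by (auto simp: image_iff) metis+
qed

text \<open>The symmetrized curl of \<open>\<eta> x\<close> is \<open>sym(x (C x)\<^sup>T)\<close> where \<open>C x\<close> is the rotated gradient
  \<open>(\<partial>\<^sub>2 \<eta>, - \<partial>\<^sub>1 \<eta>)\<close>.  The undifferentiated terms \<open>\<eta>\<close> and \<open>- \<eta>\<close> sit off the diagonal and cancel by
  symmetrization.  A rotated gradient is divergence free, hence \<open>C\<close> has trace zero.\<close>

lemma sCurl_hom_quadratic:
  assumes K: "convex K" "interior K \<noteq> {}"
  shows "sCurl K (\<lambda>x. on_set K (\<lambda>x. \<alpha> * (x $ 1)\<^sup>2 + \<beta> * x $ 1 * x $ 2 + \<gamma> * (x $ 2)\<^sup>2) x *\<^sub>R x) =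
    on_set K (X_field (0, vector [vector [\<beta>, 2 * \<gamma>], vector [- 2 * \<alpha>, - \<beta>]], 0))"
proof -
  define q where "q = (\<lambda>x. on_set K (\<lambda>x. \<alpha> * (x $ 1)\<^sup>2 + \<beta> * x $ 1 * x $ 2 + \<gamma> * (x $ 2)\<^sup>2) x *\<^sub>R x)"
  have q1: "(\<lambda>x. q x $ 1) = on_set K (cubic 0 0 0 0 0 0 \<alpha> \<beta> \<gamma> 0)"
    by (simp add: q_def on_set_def fun_eq_iff cubic_def power2_eq_square power3_eq_cube algebra_simps)
  have q2: "(\<lambda>x. q x $ 2) = on_set K (cubic 0 0 0 0 0 0 0 \<alpha> \<beta> \<gamma>)"
    by (simp add: q_def on_set_def fun_eq_iff cubic_def power2_eq_square power3_eq_cube algebra_simps)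
  have Curl: "Curl K q x $ 1 $ 1 = pd K 2 (\<lambda>x. q x $ 1) x" "Curl K q x $ 1 $ 2 = - pd K 1 (\<lambda>x. q x $ 1) x"
    "Curl K q x $ 2 $ 1 = pd K 2 (\<lambda>x. q x $ 2) x" "Curl K q x $ 2 $ 2 = - pd K 1 (\<lambda>x. q x $ 2) x" for x
    by (simp_all add: Curl_def scalar_curl_def)
  show ?thesis
    unfolding sCurl_def q_def[symmetric]
  proof
    fix x
    show "symm (Curl K q) x = on_set K (X_field (0, vector [vector [\<beta>, 2 * \<gamma>], vector [- 2 * \<alpha>, - \<beta>]], 0)) x"
      unfolding vec_eq_iff forall_2 symm_def vector_scaleR_component vector_add_component transpose_def vec_lambda_beta
        Curl q1 q2 pd_cubic[OF K]
      by (simp add: on_set_def X_field_entries cubic_def power2_eq_square field_simps)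
  qed
qed

lemma P2_tilde_eq:
  assumes K: "convex K" "interior K \<noteq> {}"
  shows "P2_tilde K = (\<lambda>p. on_set K (X_field p)) ` {(0, C, 0) | C. trace C = 0}"
proof
  show "P2_tilde K \<subseteq> (\<lambda>p. on_set K (X_field p)) ` {(0, C, 0) | C. trace C = 0}"
    unfolding P2_tilde_def hom_polys_2
  proof clarify
    fix \<alpha> \<beta> \<gamma> :: real
    have "trace (vector [vector [\<beta>, 2 * \<gamma>], vector [- 2 * \<alpha>, - \<beta>]] :: real^2^2) = 0"
      by (simp add: trace_def sum_2)
    then show "sCurl K (\<lambda>x. on_set K (\<lambda>x. \<alpha> * (x $ 1)\<^sup>2 + \<beta> * x $ 1 * x $ 2 + \<gamma> * (x $ 2)\<^sup>2) x *\<^sub>R x)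
      \<in> (\<lambda>p. on_set K (X_field p)) ` {(0, C, 0) | C. trace C = 0}"
      unfolding sCurl_hom_quadratic[OF K] by blast
  qed
  show "(\<lambda>p. on_set K (X_field p)) ` {(0, C, 0) | C. trace C = 0} \<subseteq> P2_tilde K"
  proof clarify
    fix C :: "real^2^2" assume "trace C = 0"
    then have "C = vector [vector [C$1$1, 2 * (C$1$2 / 2)], vector [- 2 * (- C$2$1 / 2), - C$1$1]]"
      by (simp add: vec_eq_iff forall_2 trace_def sum_2)
    then have "on_set K (X_field (0, C, 0)) =
      sCurl K (\<lambda>x. on_set K (\<lambda>x. (- C$2$1 / 2) * (x $ 1)\<^sup>2 + C$1$1 * x $ 1 * x $ 2 + (C$1$2 / 2) * (x $ 2)\<^sup>2) x *\<^sub>R x)"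
      unfolding sCurl_hom_quadratic[OF K] by simp
    then show "on_set K (X_field (0, C, 0)) \<in> P2_tilde K"
      unfolding P2_tilde_def hom_polys_2 by blast
  qed
qed

lemma X_tri_direct_sum:
  assumes K: "convex K" "interior K \<noteq> {}"
  shows "is_direct_sum3 (X_tri K) (sym_polys 1 K) (P2_tilde K) (xxT_P1 K)"
  unfolding X_tri_eq sym_polys_1 P2_tilde_eq[OF K] xxT_P1_eq
  by (rule is_direct_sum3_image[OF linear_X_field inj_X_field[OF K(2)] parameter_direct_sum])

section \<open>Divergence and iterated divergence\<close>

lemma div_vec_2: "div_vec K u = pd K 1 (\<lambda>y. u y $ 1) + pd K 2 (\<lambda>y. u y $ 2)"
  by (simp add: div_vec_def sum_2 plus_fun_def)

lemma Div_2: "(\<lambda>x. Div K M x $ i) = pd K 1 (\<lambda>y. M y $ i $ 1) + pd K 2 (\<lambda>y. M y $ i $ 2)"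
  by (simp add: Div_def div_vec_2 plus_fun_def)

lemma Div_X_field_entries:
  assumes K: "convex K" "interior K \<noteq> {}"
  shows "(\<lambda>x. Div K (on_set K (X_field (P, C, l))) x $ 1) = on_set K (cubic (P$1$2 + P$3$3)
           (2 * C$1$1 + (C$1$1 + C$2$2) / 2) (2 * C$1$2) (4 * l$1) (4 * l$2) 0 0 0 0 0)"
    and "(\<lambda>x. Div K (on_set K (X_field (P, C, l))) x $ 2) = on_set K (cubic (P$3$2 + P$2$3)
           (2 * C$2$1) (2 * C$2$2 + (C$1$1 + C$2$2) / 2) 0 (4 * l$1) (4 * l$2) 0 0 0 0)"
  unfolding Div_2 on_set_nth_nth X_field_cubic pd_cubic[OF K] on_set_add cubic_add
  by (simp_all add: algebra_simps add_divide_distrib)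

text \<open>Here \<open>div sym(x (C x)\<^sup>T) = 2 C x + (tr C / 2) x\<close>, and \<open>(l \<bullet> x) x x\<^sup>T\<close> has divergence
  \<open>4 (l \<bullet> x) x\<close>: by the product rule, the linear form and the first factor \<open>x\<close> contribute once
  each, and the divergence of the second factor \<open>x\<close> is two.\<close>

lemma Div_X_field:
  assumes K: "convex K" "interior K \<noteq> {}"
  shows "Div K (on_set K (X_field (P, C, l))) = on_set K (\<lambda>x. vector [P$1$2 + P$3$3, P$3$2 + P$2$3]
      + 2 *\<^sub>R (C *v x) + (trace C / 2) *\<^sub>R x + (4 * (l \<bullet> x)) *\<^sub>R x)"
proof
  fix x
  show "Div K (on_set K (X_field (P, C, l))) x = on_set K (\<lambda>x. vector [P$1$2 + P$3$3, P$3$2 + P$2$3]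
      + 2 *\<^sub>R (C *v x) + (trace C / 2) *\<^sub>R x + (4 * (l \<bullet> x)) *\<^sub>R x) x"
    using fun_cong[OF Div_X_field_entries(1)[OF K], of P C l x]
      fun_cong[OF Div_X_field_entries(2)[OF K], of P C l x]
    by (simp add: vec_eq_iff forall_2 on_set_def cubic_def trace_def matrix_vector_mult_def sum_2
        inner_vec_def power2_eq_square algebra_simps)
qed

lemma div_Div_X_field:
  assumes K: "convex K" "interior K \<noteq> {}"
  shows "div_Div K (on_set K (X_field (P, C, l))) = on_set K (\<lambda>x. 3 * trace C + (12 *\<^sub>R l) \<bullet> x)"
  unfolding div_Div_def div_vec_2 Div_X_field_entries[OF K] pd_cubic[OF K] on_set_add cubic_add
  by (rule on_set_cong) (simp add: cubic_def trace_def sum_2 inner_vec_def algebra_simps)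

text \<open>A multiple of the identity as \<open>C\<close> already reaches every constant, and \<open>l\<close> every linear form.\<close>

lemma div_Div_X_tri:
  assumes K: "convex K" "interior K \<noteq> {}"
  shows "div_Div K ` X_tri K = polys 1 K"
proof
  show "div_Div K ` X_tri K \<subseteq> polys 1 K"
    unfolding X_tri_eq polys_1 using div_Div_X_field[OF K] by fastforce
  show "polys 1 K \<subseteq> div_Div K ` X_tri K"
  proof
    fix f assume "f \<in> polys 1 K"
    then obtain \<alpha> l where f: "f = on_set K (\<lambda>x. \<alpha> + l \<bullet> x)"
      unfolding polys_1 by blast
    have "f = div_Div K (on_set K (X_field (0, (\<alpha> / 6) *\<^sub>R mat 1, (1 / 12) *\<^sub>R l)))"
      unfolding div_Div_X_field[OF K] f by (simp add: trace_def sum_2 mat_def)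
    then show "f \<in> div_Div K ` X_tri K"
      unfolding X_tri_eq by blast
  qed
qed

section \<open>Traces on the edges\<close>

lemma affine_sym_form:
  "\<exists>\<alpha> k. \<forall>x. m \<bullet> (affine_sym P x *v n) = \<alpha> + k \<bullet> x"
proof (intro exI allI)
  fix x
  define k where "k j = m$1 * n$1 * P$1$j + m$2 * n$2 * P$2$j + (m$1 * n$2 + m$2 * n$1) * P$3$j" for j
  show "m \<bullet> (affine_sym P x *v n) = k 1 + vector [k 2, k 3] \<bullet> x"
    by (simp add: k_def affine_sym_def Let_def inner_vec_def matrix_vector_mult_def sum_2 sum_3 algebra_simps)
qed

lemma sym_outer_form: "m \<bullet> (sym_outer v w *v n) = ((m \<bullet> v) * (n \<bullet> w) + (m \<bullet> w) * (n \<bullet> v)) / 2"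
  by (simp add: inner_vec_def matrix_vector_mult_def sym_outer_entry sum_2 field_simps)

text \<open>For \<open>m = n\<close> every term of degree two or three carries the factor \<open>n \<bullet> x\<close>, the cubic one twice;
  for general \<open>m\<close> the cubic term carries it once.  On an edge with normal \<open>n\<close> this factor is constant,
  which is the reason for the drop of the degree.\<close>

lemma X_field_form:
  assumes "\<And>x. m \<bullet> (affine_sym P x *v n) = \<alpha> + k \<bullet> x"
  shows "m \<bullet> (X_field (P, C, l) x *v n) = \<alpha> + k \<bullet> x
    + ((m \<bullet> x) * ((n v* C) \<bullet> x) + (n \<bullet> x) * ((m v* C) \<bullet> x)) / 2 + (l \<bullet> x) * (m \<bullet> x) * (n \<bullet> x)"
  by (simp add: X_field_def matrix_vector_mult_add_rdistrib inner_add_right assms sym_outer_form dot_lmul_matrix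
      scaleR_matrix_vector_assoc[symmetric])

lemma edge_properties:
  assumes "pos_triangle a b c" "(u, v) \<in> edges a b c"
  shows "closed_segment u v \<subseteq> triangle_of a b c" "u \<noteq> v"
    "edge_tangent u v \<bullet> edge_tangent u v = 1"
    "x \<in> closed_segment u v \<Longrightarrow> edge_normal u v \<bullet> x = edge_normal u v \<bullet> u"
proof -
  show "closed_segment u v \<subseteq> triangle_of a b c"
    unfolding triangle_of_def segment_convex_hull
    by (rule hull_mono) (use assms(2) in \<open>auto simp: edges_def\<close>)
  show ne: "u \<noteq> v"
    using assms by (auto simp: edges_def pos_triangle_def det_B_mat)
  show "edge_tangent u v \<bullet> edge_tangent u v = 1"
    unfolding norm_eq_1[symmetric] using ne by (simp add: edge_tangent_def)
  assume "x \<in> closed_segment u v"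
  then obtain s where "x = u + s *\<^sub>R (v - u)"
    by (auto simp: in_segment algebra_simps)
  moreover have "v - u = norm (v - u) *\<^sub>R edge_tangent u v"
    using ne by (simp add: edge_tangent_def)
  ultimately have "x = u + (s * norm (v - u)) *\<^sub>R edge_tangent u v"
    by (metis scaleR_scaleR)
  then show "edge_normal u v \<bullet> x = edge_normal u v \<bullet> u"
    using normal_exterior(2)[OF assms] by (simp add: inner_add_right)
qed

lemma nMn_in_P1:
  assumes "pos_triangle a b c" "(u, v) \<in> edges a b c" and K: "K = triangle_of a b c"
    and "M \<in> X_tri K"
  shows "nMn u v M \<in> polys 1 (closed_segment u v)"
proof -
  obtain P C l where M: "M = on_set K (X_field (P, C, l))"
    using assms(4) unfolding X_tri_eq by (metis imageE prod_cases3)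
  define n where "n = edge_normal u v"
  define \<nu> where "\<nu> = n \<bullet> u"
  obtain \<alpha> k where form: "\<And>x. n \<bullet> (affine_sym P x *v n) = \<alpha> + k \<bullet> x"
    using affine_sym_form[of n P n] by metis
  have "nMn u v M = on_set (closed_segment u v) (\<lambda>x. \<alpha> + (k + \<nu> *\<^sub>R (n v* C) + \<nu>\<^sup>2 *\<^sub>R l) \<bullet> x)"
    unfolding nMn_def n_def[symmetric]
  proof (rule on_set_cong)
    fix x assume x: "x \<in> closed_segment u v"
    have "n \<bullet> x = \<nu>"
      using edge_properties(4)[OF assms(1,2) x] by (simp add: n_def \<nu>_def)
    moreover have "x \<in> K"
      using edge_properties(1)[OF assms(1,2)] x K by blast
    ultimately show "n \<bullet> (M x *v n) = \<alpha> + (k + \<nu> *\<^sub>R (n v* C) + \<nu>\<^sup>2 *\<^sub>R l) \<bullet> x"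
      by (simp add: M on_set_def X_field_form[OF form] inner_add_left power2_eq_square algebra_simps)
  qed
  then show ?thesis
    unfolding polys_1 by blast
qed

text \<open>At an end point of the edge the derivative is one-sided.  Uniqueness holds at every point because
  the parameters \<open>s\<close> that stay on the edge form a nondegenerate interval.\<close>

lemma tangential_deriv_eq:
  assumes "u \<noteq> v" "x \<in> closed_segment u v"
    and "((\<lambda>s. g (x + s *\<^sub>R edge_tangent u v)) has_vector_derivative D) (at 0)"
    and "\<And>y. y \<in> closed_segment u v \<Longrightarrow> f y = g y"
  shows "tangential_deriv (closed_segment u v) (edge_tangent u v) f x = D"
  unfolding tangential_deriv_def
proof (rule vector_derivative_within)
  define t where "t = edge_tangent u v"
  define A where "A = {s. x + s *\<^sub>R t \<in> closed_segment u v}"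
  have vu: "v - u = norm (v - u) *\<^sub>R t"
    using assms(1) by (simp add: t_def edge_tangent_def)
  obtain r where r: "x = u + r *\<^sub>R (v - u)" "0 \<le> r" "r \<le> 1"
    using assms(2) by (auto simp: in_segment algebra_simps)
  have on_line: "x + ((r' - r) * norm (v - u)) *\<^sub>R t = u + r' *\<^sub>R (v - u)" for r'
    unfolding scaleR_scaleR[symmetric] vu[symmetric] by (simp add: r(1) algebra_simps)
  have in_A: "(r' - r) * norm (v - u) \<in> A" if "0 \<le> r'" "r' \<le> 1" for r'
    unfolding A_def mem_Collect_eq on_line using that by (auto simp: in_segment algebra_simps intro!: exI[of _ r'])
  have "0 \<in> A"
    using assms(2) by (simp add: A_def)
  have "convex A"
  proof -
    have "A = (\<lambda>s. s *\<^sub>R t) -` ((\<lambda>y. - x + y) ` closed_segment u v)"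
      by (force simp: A_def)
    then show ?thesis
      by (auto intro!: convex_linear_vimage convex_translation linearI simp: algebra_simps)
  qed
  moreover have "A \<noteq> {s}" for s
    using in_A[of 0] in_A[of 1] assms(1) by (auto simp: algebra_simps)
  ultimately have "0 islimpt A"
    using \<open>0 \<in> A\<close> by (intro connected_imp_perfect convex_connected)
  then show "at 0 within {s. x + s *\<^sub>R edge_tangent u v \<in> closed_segment u v} \<noteq> bot"
    by (simp add: A_def t_def trivial_limit_within)
  show "((\<lambda>s. f (x + s *\<^sub>R edge_tangent u v)) has_vector_derivative D)
     (at 0 within {s. x + s *\<^sub>R edge_tangent u v \<in> closed_segment u v})"
    using assms(3)[THEN has_vector_derivative_at_within]
    by (rule has_vector_derivative_transform[rotated 2]) (use assms(2,4) in auto)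
qed

text \<open>With \<open>n \<bullet> x = \<nu>\<close> on the edge, \<open>n \<bullet> div M\<close> is affine since its only quadratic term is
  \<open>4 (l \<bullet> x) (n \<bullet> x)\<close>.  The function \<open>t \<bullet> M n\<close> is quadratic along the edge, so its tangential
  derivative is affine.\<close>

lemma eff_shear_in_P1:
  assumes "pos_triangle a b c" "(u, v) \<in> edges a b c" and K: "K = triangle_of a b c"
    and "M \<in> X_tri K"
  shows "eff_shear K u v M \<in> polys 1 (closed_segment u v)"
proof -
  obtain P C l where M: "M = on_set K (X_field (P, C, l))"
    using assms(4) unfolding X_tri_eq by (metis imageE prod_cases3)
  define n where "n = edge_normal u v"
  define t where "t = edge_tangent u v"
  define E where "E = closed_segment u v"
  define \<nu> where "\<nu> = n \<bullet> u"
  have nt: "n \<bullet> t = 0" and tt: "t \<bullet> t = 1" and EK: "E \<subseteq> K"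
    using normal_exterior(2)[OF assms(1,2)] edge_properties(1,3)[OF assms(1,2)]
    by (simp_all add: n_def t_def E_def K)
  obtain \<alpha> k where form: "\<And>x. t \<bullet> (affine_sym P x *v n) = \<alpha> + k \<bullet> x"
    using affine_sym_form[of t P n] by metis
  define d where "d = (vector [P$1$2 + P$3$3, P$3$2 + P$2$3] :: real^2)"
  define g where "g y = t \<bullet> (X_field (P, C, l) y *v n)" for y
  define g' where "g' x = k \<bullet> t + ((n v* C) \<bullet> x + (t \<bullet> x) * ((n v* C) \<bullet> t) + \<nu> * ((t v* C) \<bullet> t)) / 2
     + ((l \<bullet> t) * (t \<bullet> x) + l \<bullet> x) * \<nu>" for x
  have deriv: "((\<lambda>s. g (x + s *\<^sub>R t)) has_vector_derivative g' x) (at 0)" if "n \<bullet> x = \<nu>" for x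
    unfolding has_real_derivative_iff_has_vector_derivative[symmetric] g_def X_field_form[OF form]
      inner_add_right inner_scaleR_right nt tt that
    by (auto intro!: derivative_eq_intros simp: g'_def algebra_simps add_divide_distrib)
  \<comment> \<open>The divergence contributes \<open>2\<close> and \<open>4\<close> to the factors \<open>5 / 2\<close> and \<open>5\<close>, the tangential derivative \<open>1 / 2\<close> and \<open>1\<close>.\<close>
  have "eff_shear K u v M = on_set E (\<lambda>x. (n \<bullet> d + trace C / 2 * \<nu> + k \<bullet> t + \<nu> * ((t v* C) \<bullet> t) / 2)
     + ((5 / 2) *\<^sub>R (n v* C) + (5 * \<nu>) *\<^sub>R l + (((n v* C) \<bullet> t) / 2 + \<nu> * (l \<bullet> t)) *\<^sub>R t) \<bullet> x)"
    unfolding eff_shear_def n_def[symmetric] t_def[symmetric] E_def[symmetric]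
  proof (rule on_set_cong)
    fix x assume x: "x \<in> E"
    have nx: "n \<bullet> x = \<nu>"
      using edge_properties(4)[OF assms(1,2) x[unfolded E_def]] by (simp add: n_def \<nu>_def)
    have xK: "x \<in> K"
      using EK x by blast
    have "tangential_deriv E t (\<lambda>y. t \<bullet> (M y *v n)) x = g' x"
      unfolding E_def t_def
      by (rule tangential_deriv_eq[where g = g])
        (use edge_properties(2)[OF assms(1,2)] x deriv[OF nx] EK in \<open>auto simp: E_def t_def g_def M on_set_def\<close>)
    moreover have "n \<bullet> Div K M x = n \<bullet> d + 2 * ((n v* C) \<bullet> x) + trace C / 2 * \<nu> + 4 * (l \<bullet> x) * \<nu>"
      unfolding M Div_X_field[OF convex_triangle interior_triangle_nonempty[OF assms(1)], folded K]
      by (simp add: on_set_def xK inner_add_right d_def dot_lmul_matrix nx)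
    ultimately show "n \<bullet> Div K M x + tangential_deriv E t (\<lambda>y. t \<bullet> (M y *v n)) x =
       (n \<bullet> d + trace C / 2 * \<nu> + k \<bullet> t + \<nu> * ((t v* C) \<bullet> t) / 2)
       + ((5 / 2) *\<^sub>R (n v* C) + (5 * \<nu>) *\<^sub>R l + (((n v* C) \<bullet> t) / 2 + \<nu> * (l \<bullet> t)) *\<^sub>R t) \<bullet> x"
      by (simp add: g'_def inner_add_left field_simps)
  qed
  then show ?thesis
    unfolding polys_1 E_def by blast
qed

section \<open>The properties of the tensor space\<close>

theorem proposition4:
  fixes a b c :: "real^2" and K :: "(real^2) set"
  assumes "pos_triangle a b c" and "K = triangle_of a b c"
  shows "(\<forall>Mh. sym_field ref_triangle Mh \<longrightarrow>
            (Mh \<in> X_tri ref_triangle \<longleftrightarrow> piola a b c Mh \<in> X_tri K)) \<and>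
         is_direct_sum3 (X_tri K) (sym_polys 1 K) (P2_tilde K) (xxT_P1 K) \<and>
         dim (X_tri K) = 15 \<and>
         (sym_polys 1 K \<subseteq> X_tri K \<and> X_tri K \<subseteq> sym_polys 3 K) \<and>
         div_Div K ` X_tri K = polys 1 K \<and>
         (\<forall>(u, v) \<in> edges a b c. \<forall>M \<in> X_tri K. nMn u v M \<in> polys 1 (closed_segment u v)) \<and>
         (\<forall>(u, v) \<in> edges a b c. \<forall>M \<in> X_tri K. eff_shear K u v M \<in> polys 1 (closed_segment u v))"
proof -
  have K: "convex K" "interior K \<noteq> {}"
    using assms convex_triangle interior_triangle_nonempty by auto
  have "sym_polys 1 K \<subseteq> X_tri K"
    unfolding sym_polys_1 X_tri_eq by blast
  then show ?thesis
    using piola_X_tri_iff[OF assms(1)] X_tri_direct_sum[OF K] dim_X_tri[OF K(2)] X_tri_cubic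
      div_Div_X_tri[OF K] nMn_in_P1[OF assms(1) _ assms(2)] eff_shear_in_P1[OF assms(1) _ assms(2)]
    unfolding assms(2)[symmetric] by (intro conjI) blast+
qed

end
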